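(* Suppose that $\mathbf{n}\times(\mathbf{E}(\sigma)-\mathbf{E}_0)\neq0$ on $\Gamma$. Then $\sigma\mathbf{E}(\sigma)$ is not uniquely determined by the data $\mathbf{n}\times(\mathbf{E}(\sigma)-\mathbf{E}_0)|_\Gamma$, in the sense of the inverse source problem: there exists $\mathbf{J}\in L^2(\Omega_c)^3$ (extended by zero to $\Omega$) with $\mathbf{J}\neq i\omega\sigma\mathbf{E}(\sigma)$ such that the solution $\mathbf{E}$ of $$\nabla\times(\mu^{-1}\nabla\times\mathbf{E})-i\omega\sigma_0\mathbf{E}=\mathbf{J}\ \text{in }\Omega,\qquad\nabla\cdot\varepsilon\mathbf{E}=0\ \text{in }\Omega_0,$$ with boundary conditions $\mathbf{n}\times\nabla\times\mathbf{E}=0$ and $\mathbf{n}\cdot\mathbf{E}=0$ on $\Gamma$, $\mathbf{n}\times\mathbf{E}=0$ on $\Gamma_D$, satisfies $\mathbf{n}\times\mathbf{E}=\mathbf{n}\times(\mathbf{E}(\sigma)-\mathbf{E}_0)$ on $\Gamma$.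
   Context: Geometry: $\Omega\subset\mathbb{R}^3$ is a bounded convex domain with piecewise smooth boundary; $\Omega_0\subset\Omega$ is a simply-connected subdomain (air, where the conductivity vanishes) and $\Omega_c=\Omega\setminus\overline{\Omega}_0$ (conductor). Both $\Omega_0$ and $\Omega_c$ are simply-connected polyhedrons, and the interface $\Gamma_{0c}$ between them is a simply-connected Lipschitz polyhedral surface. $\Gamma\subset\partial\Omega$ is the measurement surface, part of $\partial\Omega_0$; $\Gamma_D=\partial\Omega\setminus\overline\Gamma$; $\mathbf{n}$ is the outward unit normal. Coefficients: $\omega>0$ is the frequency; the magnetic permeability $\mu>0$ is piecewise constant; the electric permittivity $\varepsilon>0$ is piecewise constant in $\Omega_0$. The conductivity of the medium is $\sigma_0+\sigma$ in $\Omega$, where $\sigma_0$ is a known positive constant in $\Omega_c$ and zero in $\Omega_0$, and the abnormal conductivity $\sigma$ is a real-valued function compactly supported in $\Omega_c$. The source $\mathbf{J}_s$ is compactly supported in $\Omega_0$ with $\nabla\cdot\mathbf{J}_s=0$. $\mathbf{E}(\sigma)$ is the solution of $\nabla\times(\mu^{-1}\nabla\times\mathbf{E})-i\omega(\sigma_0+\sigma)\mathbf{E}=i\omega\mathbf{J}_s$ in $\Omega$, $\nabla\cdot\varepsilon\mathbf{E}=0$ in $\Omega_0$, with boundary conditions $\mathbf{n}\times\nabla\times\mathbf{E}=0$ and $\mathbf{n}\cdot\mathbf{E}=0$ on $\Gamma$, $\mathbf{n}\times\mathbf{E}=0$ on $\Gamma_D$. The background field $\mathbf{E}_0$ is the solution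 of the same problem with $\sigma=0$. All these problems are understood in the weak sense: for a right-hand side $\mathbf{f}$ and conductivity $\kappa$, find $(\mathbf{E},\phi)\in H_\Gamma(\mathbf{curl};\Omega)\times H^1_\Gamma(\Omega_0)$ with $$\int_\Omega \mu^{-1}\nabla\times\mathbf{E}\cdot\nabla\times\overline{\mathbf{F}}-i\omega\kappa\,\mathbf{E}\cdot\overline{\mathbf{F}}\,dx+\int_{\Omega_0}\varepsilon\nabla\phi\cdot\overline{\mathbf{F}}\,dx=\int_\Omega\mathbf{f}\cdot\overline{\mathbf{F}}\,dx,\qquad \int_{\Omega_0}\varepsilon\mathbf{E}\cdot\nabla\overline\psi\,dx=0$$ for all $\mathbf{F}\in H_\Gamma(\mathbf{curl};\Omega)=\{\mathbf{u}\in L^2(\Omega)^3: \nabla\times\mathbf{u}\in L^2(\Omega)^3,\ \mathbf{n}\times\mathbf{u}=0\text{ on }\Gamma_D\}$ and all $\psi\in H^1_\Gamma(\Omega_0)=\{v\in H^1(\Omega_0): v=0\text{ on }\partial\Omega_0\setminus\Gamma\}$. Note that $\mathbf{E}(\sigma)-\mathbf{E}_0$ solves the problem in the claim with $\mathbf{J}=i\omega\sigma\mathbf{E}(\sigma)$. The inverse source problem is: given $\mathbf{n}\times\mathbf{E}$ on $\Gamma$, find the source $\mathbf{J}$ supported in $\Omega_c$. *)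

theory Defs
  imports "HOL-Analysis.Analysis"
begin

section \<open>Smooth functions and classical differential operators\<close>

primrec k_times_cont_diff ::
  "nat \<Rightarrow> ('a::euclidean_space \<Rightarrow> 'b::real_normed_vector) \<Rightarrow> bool" where
  "k_times_cont_diff 0 f \<longleftrightarrow> continuous_on UNIV f"
| "k_times_cont_diff (Suc k) f \<longleftrightarrow>
     (\<forall>x. f differentiable (at x)) \<and>
     (\<forall>v. k_times_cont_diff k (\<lambda>x. frechet_derivative f (at x) v))"

definition smooth_fun :: "('a::euclidean_space \<Rightarrow> 'b::real_normed_vector) \<Rightarrow> bool" where
  "smooth_fun f \<longleftrightarrow> (\<forall>k. k_times_cont_diff k f)"

definition supp :: "('a::topological_space \<Rightarrow> 'b::zero) \<Rightarrow> 'a set" where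
  "supp f = closure {x. f x \<noteq> 0}"

definition compactly_supported_in ::
  "'a::topological_space set \<Rightarrow> ('a \<Rightarrow> 'b::zero) \<Rightarrow> bool" where
  "compactly_supported_in D f \<longleftrightarrow> compact (supp f) \<and> supp f \<subseteq> D"

definition test_functions ::
  "'a::euclidean_space set \<Rightarrow> ('a \<Rightarrow> 'b::real_normed_vector) set" where
  "test_functions D = {f. smooth_fun f \<and> compactly_supported_in D f}"

definition partial :: "3 \<Rightarrow> (real^3 \<Rightarrow> complex) \<Rightarrow> real^3 \<Rightarrow> complex" where
  "partial i f x = frechet_derivative f (at x) (axis i 1)"

definition gradient :: "(real^3 \<Rightarrow> complex) \<Rightarrow> real^3 \<Rightarrow> complex^3" where
  "gradient f x = (\<chi> i. partial i f x)"

definition divergence :: "(real^3 \<Rightarrow> complex^3) \<Rightarrow> real^3 \<Rightarrow> complex" where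
  "divergence u x = (\<Sum>i\<in>UNIV. partial i (\<lambda>y. u y $ i) x)"

definition curl :: "(real^3 \<Rightarrow> complex^3) \<Rightarrow> real^3 \<Rightarrow> complex^3" where
  "curl u x = vector
     [partial 2 (\<lambda>y. u y $ 3) x - partial 3 (\<lambda>y. u y $ 2) x,
      partial 3 (\<lambda>y. u y $ 1) x - partial 1 (\<lambda>y. u y $ 3) x,
      partial 1 (\<lambda>y. u y $ 2) x - partial 2 (\<lambda>y. u y $ 1) x]"

text \<open>The product \<open>a \<cdot> cnj b\<close> on complex 3-space; the library's inner product on this type is
  only its real part.\<close>

definition hdot :: "complex^3 \<Rightarrow> complex^3 \<Rightarrow> complex" where
  "hdot a b = (\<Sum>i\<in>UNIV. a $ i * cnj (b $ i))"


section \<open>Weak derivatives, traces and function spaces\<close>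

text \<open>Functions are total; only their values on the domain \<open>D\<close> matter, up to null sets.
  Weak derivatives are rendered as relations: an element of a Sobolev space is presented together
  with a representative of its weak derivative.\<close>

definition L2_on :: "(real^3) set \<Rightarrow> (real^3 \<Rightarrow> 'b::euclidean_space) \<Rightarrow> bool" where
  "L2_on D u \<longleftrightarrow> set_borel_measurable lebesgue D u \<and>
                 set_integrable lebesgue D (\<lambda>x. (norm (u x))\<^sup>2)"

definition weak_curl_on ::
  "(real^3) set \<Rightarrow> (real^3 \<Rightarrow> complex^3) \<Rightarrow> (real^3 \<Rightarrow> complex^3) \<Rightarrow> bool" where
  "weak_curl_on D u w \<longleftrightarrow>
     (\<forall>\<Phi>\<in>test_functions D.
        (LINT x:D|lebesgue. hdot (w x) (\<Phi> x)) = (LINT x:D|lebesgue. hdot (u x) (curl \<Phi> x)))"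

definition weak_gradient_on ::
  "(real^3) set \<Rightarrow> (real^3 \<Rightarrow> complex) \<Rightarrow> (real^3 \<Rightarrow> complex^3) \<Rightarrow> bool" where
  "weak_gradient_on D v g \<longleftrightarrow>
     (\<forall>\<Phi>\<in>test_functions D.
        (LINT x:D|lebesgue. hdot (g x) (\<Phi> x))
          = - (LINT x:D|lebesgue. v x * cnj (divergence \<Phi> x)))"

definition weakly_divergence_free_on :: "(real^3) set \<Rightarrow> (real^3 \<Rightarrow> complex^3) \<Rightarrow> bool" where
  "weakly_divergence_free_on D u \<longleftrightarrow>
     (\<forall>\<psi>\<in>test_functions D. (LINT x:D|lebesgue. hdot (u x) (gradient \<psi> x)) = 0)"

text \<open>\<open>Hcurl D u w\<close>: \<open>u\<close> belongs to \<open>H(curl; D)\<close> and its curl is \<open>w\<close>.\<close>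

definition Hcurl ::
  "(real^3) set \<Rightarrow> (real^3 \<Rightarrow> complex^3) \<Rightarrow> (real^3 \<Rightarrow> complex^3) \<Rightarrow> bool" where
  "Hcurl D u w \<longleftrightarrow> L2_on D u \<and> L2_on D w \<and> weak_curl_on D u w"

text \<open>\<open>H1 D v g\<close>: \<open>v\<close> belongs to \<open>H\<^sup>1(D)\<close> and its gradient is \<open>g\<close>.\<close>

definition H1 :: "(real^3) set \<Rightarrow> (real^3 \<Rightarrow> complex) \<Rightarrow> (real^3 \<Rightarrow> complex^3) \<Rightarrow> bool" where
  "H1 D v g \<longleftrightarrow> L2_on D v \<and> L2_on D g \<and> weak_gradient_on D v g"

text \<open>Traces are distributions on the boundary, given by Green's formulas
  \<open>\<integral>\<^bsub>\<partial>D\<^esub> (n \<times> u) \<cdot> cnj \<Phi> = \<integral>\<^bsub>D\<^esub> curl u \<cdot> cnj \<Phi> - u \<cdot> curl (cnj \<Phi>)\<close> and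
  \<open>\<integral>\<^bsub>\<partial>D\<^esub> v n \<cdot> cnj \<Phi> = \<integral>\<^bsub>D\<^esub> grad v \<cdot> cnj \<Phi> + v div (cnj \<Phi>)\<close>.
  Such a distribution is restricted to a part \<open>S\<close> of the boundary by admitting only test fields
  whose support meets the boundary inside \<open>S\<close>.\<close>

definition boundary_test_fields ::
  "(real^3) set \<Rightarrow> (real^3) set \<Rightarrow> (real^3 \<Rightarrow> complex^3) set" where
  "boundary_test_fields D S = {\<Phi>\<in>test_functions UNIV. supp \<Phi> \<inter> frontier D \<subseteq> S}"

definition tangential_trace ::
  "(real^3) set \<Rightarrow> (real^3 \<Rightarrow> complex^3) \<Rightarrow> (real^3 \<Rightarrow> complex^3) \<Rightarrow> (real^3 \<Rightarrow> complex^3) \<Rightarrow> complex"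
  where
  "tangential_trace D u w \<Phi> =
     (LINT x:D|lebesgue. hdot (w x) (\<Phi> x) - hdot (u x) (curl \<Phi> x))"

text \<open>\<open>n \<times> u = n \<times> v\<close> on \<open>S\<close>, for \<open>u\<close> and \<open>v\<close> in \<open>H(curl; D)\<close>.\<close>

definition tangential_trace_eq ::
  "(real^3) set \<Rightarrow> (real^3) set \<Rightarrow> (real^3 \<Rightarrow> complex^3) \<Rightarrow> (real^3 \<Rightarrow> complex^3) \<Rightarrow> bool" where
  "tangential_trace_eq D S u v \<longleftrightarrow>
     (\<exists>w z. Hcurl D u w \<and> Hcurl D v z \<and>
        (\<forall>\<Phi>\<in>boundary_test_fields D S. tangential_trace D u w \<Phi> = tangential_trace D v z \<Phi>))"

definition normal_trace ::
  "(real^3) set \<Rightarrow> (real^3 \<Rightarrow> complex) \<Rightarrow> (real^3 \<Rightarrow> complex^3) \<Rightarrow> (real^3 \<Rightarrow> complex^3) \<Rightarrow> complex"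
  where
  "normal_trace D v g \<Phi> =
     (LINT x:D|lebesgue. hdot (g x) (\<Phi> x) + v x * cnj (divergence \<Phi> x))"

text \<open>\<open>H\<^sub>\<Gamma>(curl; \<Omega>)\<close>: here \<open>\<Gamma>\<^sub>D\<close> is \<open>frontier \<Omega> - closure \<Gamma>\<close>.\<close>

definition Hcurl_Gamma ::
  "(real^3) set \<Rightarrow> (real^3) set \<Rightarrow> (real^3 \<Rightarrow> complex^3) \<Rightarrow> (real^3 \<Rightarrow> complex^3) \<Rightarrow> bool" where
  "Hcurl_Gamma \<Omega> \<Gamma> u w \<longleftrightarrow>
     Hcurl \<Omega> u w \<and> tangential_trace_eq \<Omega> (frontier \<Omega> - closure \<Gamma>) u (\<lambda>_. 0)"

definition H1_Gamma ::
  "(real^3) set \<Rightarrow> (real^3) set \<Rightarrow> (real^3 \<Rightarrow> complex) \<Rightarrow> (real^3 \<Rightarrow> complex^3) \<Rightarrow> bool" where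
  "H1_Gamma \<Omega>0 \<Gamma> v g \<longleftrightarrow>
     H1 \<Omega>0 v g \<and>
     (\<forall>\<Phi>\<in>boundary_test_fields \<Omega>0 (frontier \<Omega>0 - \<Gamma>). normal_trace \<Omega>0 v g \<Phi> = 0)"


section \<open>The weak eddy current problem\<close>

text \<open>\<open>E\<close> (together with some multiplier \<open>\<phi>\<close>) solves the problem with conductivity \<open>\<kappa>\<close> and
  right-hand side \<open>f\<close>. The conditions \<open>n \<times> curl E = 0\<close>, \<open>n \<cdot> E = 0\<close> on \<open>\<Gamma>\<close> and
  \<open>div (\<epsilon> E) = 0\<close> in \<open>\<Omega>0\<close> are encoded by the variational equations.\<close>

definition weak_solution ::
  "(real^3) set \<Rightarrow> (real^3) set \<Rightarrow> (real^3) set \<Rightarrow> (real^3 \<Rightarrow> real) \<Rightarrow> (real^3 \<Rightarrow> real) \<Rightarrow> real \<Rightarrow>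
   (real^3 \<Rightarrow> real) \<Rightarrow> (real^3 \<Rightarrow> complex^3) \<Rightarrow> (real^3 \<Rightarrow> complex^3) \<Rightarrow> bool" where
  "weak_solution \<Omega> \<Omega>0 \<Gamma> \<mu> \<epsilon> \<omega> \<kappa> f E \<longleftrightarrow>
     (\<exists>curlE \<phi> grad\<phi>.
        Hcurl_Gamma \<Omega> \<Gamma> E curlE \<and> H1_Gamma \<Omega>0 \<Gamma> \<phi> grad\<phi> \<and>
        (\<forall>F curlF. Hcurl_Gamma \<Omega> \<Gamma> F curlF \<longrightarrow>
           (LINT x:\<Omega>|lebesgue. complex_of_real (inverse (\<mu> x)) * hdot (curlE x) (curlF x)
                              - \<i> * complex_of_real (\<omega> * \<kappa> x) * hdot (E x) (F x))
           + (LINT x:\<Omega>0|lebesgue. complex_of_real (\<epsilon> x) * hdot (grad\<phi> x) (F x))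
           = (LINT x:\<Omega>|lebesgue. hdot (f x) (F x))) \<and>
        (\<forall>\<psi> grad\<psi>. H1_Gamma \<Omega>0 \<Gamma> \<psi> grad\<psi> \<longrightarrow>
           (LINT x:\<Omega>0|lebesgue. complex_of_real (\<epsilon> x) * hdot (E x) (grad\<psi> x)) = 0))"

text \<open>\<open>E\<close> is \<^emph>\<open>the\<close> solution; uniqueness is up to null sets.\<close>

definition is_the_solution ::
  "(real^3) set \<Rightarrow> (real^3) set \<Rightarrow> (real^3) set \<Rightarrow> (real^3 \<Rightarrow> real) \<Rightarrow> (real^3 \<Rightarrow> real) \<Rightarrow> real \<Rightarrow>
   (real^3 \<Rightarrow> real) \<Rightarrow> (real^3 \<Rightarrow> complex^3) \<Rightarrow> (real^3 \<Rightarrow> complex^3) \<Rightarrow> bool" where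
  "is_the_solution \<Omega> \<Omega>0 \<Gamma> \<mu> \<epsilon> \<omega> \<kappa> f E \<longleftrightarrow>
     weak_solution \<Omega> \<Omega>0 \<Gamma> \<mu> \<epsilon> \<omega> \<kappa> f E \<and>
     (\<forall>E'. weak_solution \<Omega> \<Omega>0 \<Gamma> \<mu> \<epsilon> \<omega> \<kappa> f E' \<longrightarrow> (AE x in lebesgue. x \<in> \<Omega> \<longrightarrow> E' x = E x))"


section \<open>Geometry and coefficients\<close>

definition is_domain :: "(real^3) set \<Rightarrow> bool" where
  "is_domain D \<longleftrightarrow> open D \<and> connected D \<and> D \<noteq> {}"

text \<open>The boundary consists of finitely many compact pieces of regular smooth level surfaces.\<close>

definition piecewise_smooth_boundary :: "(real^3) set \<Rightarrow> bool" where
  "piecewise_smooth_boundary D \<longleftrightarrow>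
     (\<exists>\<S>. finite \<S> \<and> frontier D = \<Union>\<S> \<and>
        (\<forall>S\<in>\<S>. compact S \<and>
           (\<exists>g :: real^3 \<Rightarrow> real. smooth_fun g \<and>
              (\<forall>x\<in>S. g x = 0 \<and> frechet_derivative g (at x) \<noteq> (\<lambda>_. 0)))))"

text \<open>Open polyhedra, not necessarily convex (unlike the library's \<open>polyhedron\<close>).\<close>

definition polyhedral_domain :: "(real^3) set \<Rightarrow> bool" where
  "polyhedral_domain D \<longleftrightarrow>
     is_domain D \<and> interior (closure D) = D \<and>
     (\<exists>\<P>. finite \<P> \<and> (\<forall>P\<in>\<P>. polytope P) \<and> closure D = \<Union>\<P>)"

text \<open>A finite union of planar convex polygons that is a Lipschitz 2-manifold, possibly with
  boundary: every point has a bi-Lipschitz chart onto a relatively open subset of a half-plane.\<close>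

definition Lipschitz_polyhedral_surface :: "(real^3) set \<Rightarrow> bool" where
  "Lipschitz_polyhedral_surface S \<longleftrightarrow>
     (\<exists>\<P>. finite \<P> \<and> (\<forall>P\<in>\<P>. polytope P \<and> aff_dim P = 2) \<and> S = \<Union>\<P>) \<and>
     (\<forall>p\<in>S. \<exists>U (V :: (real^2) set) f g L.
        p \<in> U \<and> openin (top_of_set S) U \<and> openin (top_of_set {y. 0 \<le> y $ 1}) V \<and>
        homeomorphism U V f g \<and> L-lipschitz_on U f \<and> L-lipschitz_on V g)"

text \<open>The values on the null set left over by the pieces are irrelevant.\<close>

definition piecewise_constant_on :: "(real^3) set \<Rightarrow> (real^3 \<Rightarrow> real) \<Rightarrow> bool" where
  "piecewise_constant_on D f \<longleftrightarrow>
     (\<exists>\<D>. finite \<D> \<and> (\<forall>A\<in>\<D>. is_domain A \<and> A \<subseteq> D \<and> f constant_on A) \<and>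
        pairwise disjnt \<D> \<and> negligible (D - \<Union>\<D>))"

definition Linfty :: "(real^3 \<Rightarrow> real) \<Rightarrow> bool" where
  "Linfty f \<longleftrightarrow> f \<in> borel_measurable lebesgue \<and> (\<exists>B. AE x in lebesgue. \<bar>f x\<bar> \<le> B)"

end

theory Submission
  imports Defs
begin

text \<open>
  The data only see the trace of \<open>E\<close> on \<open>\<Gamma>\<close>, so a source is invisible as soon as the field that it
  radiates vanishes near the boundary. Such non-radiating sources are easily produced by choosing
  the field first: every regular \<open>\<delta>\<close> with compact support in the conductor \<open>\<Omega>c\<close> solves the eddy current
  problem with source \<open>curl (\<mu>\<^sup>-\<^sup>1 curl \<delta>) - i \<omega> \<sigma>0 \<delta>\<close>. Since \<open>\<mu>\<close> jumps, the first term need not be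
  square integrable; taking \<open>\<delta>\<close> curl-free removes it and leaves the source \<open>- i \<omega> \<sigma>0 \<delta>\<close>, which is
  nonzero because \<open>\<sigma>0\<close> is a positive constant on \<open>\<Omega>c\<close>. The constraint \<open>div (\<epsilon> E) = 0\<close> in the air
  region \<open>\<Omega>0\<close> is unaffected because \<open>\<delta>\<close> vanishes there.

  Accordingly \<open>J = i \<omega> \<sigma> E\<sigma> - i \<omega> \<sigma>0 \<delta>\<close> has the solution \<open>E = (E\<sigma> - E0) + \<delta>\<close>: moving the term with
  \<open>\<sigma>\<close> to the right-hand side (\<open>weak_solution_conductivity_to_source\<close>) shows that \<open>E\<sigma> - E0\<close> is a
  solution with source \<open>i \<omega> \<sigma> E\<sigma>\<close>, the field \<open>\<delta>\<close> is one with source \<open>- i \<omega> \<sigma>0 \<delta>\<close>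
  (\<open>weak_solution_curl_free\<close>), and the problem is linear (\<open>weak_solution_add_cscale\<close>). Uniqueness for
  the new source is inherited from the uniqueness of \<open>E0\<close>: it is a property of the homogeneous
  problem (\<open>is_the_solution_other_source\<close>).

  The field \<open>\<delta>\<close> is radial, \<open>\<delta> x = k (\<bar>x - a\<bar>\<^sup>2) (x - a)\<close> with a cut-off function \<open>k\<close>. Its Jacobian is
  symmetric, so integrating by parts over the whole space gives \<open>\<integral> \<delta> \<cdot> curl \<Phi> = 0\<close> for all test
  fields \<open>\<Phi>\<close> (\<open>integral_radial_field_curl_test\<close>); this identity expresses at once that \<open>\<delta>\<close> is
  curl-free and that its tangential trace is zero.
\<close>

section \<open>Square integrable fields and bounded coefficients\<close>

lemma bounded_bilinear_mult_cnj: "bounded_bilinear (\<lambda>a b. a * cnj b)"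
  using bounded_bilinear.comp[OF bounded_bilinear_mult bounded_linear_ident bounded_linear_cnj] .

lemma bounded_bilinear_hdot: "bounded_bilinear hdot"
proof -
  have comp: "bounded_bilinear (\<lambda>(a :: complex^3) (b :: complex^3). a $ i * cnj (b $ i))" for i
    using bounded_bilinear.comp[OF bounded_bilinear_mult_cnj bounded_linear_vec_nth bounded_linear_vec_nth] .
  have add: "bounded_bilinear (\<lambda>a b. p a b + q a b)"
    if p: "bounded_bilinear p" and q: "bounded_bilinear q"
    for p q :: "complex^3 \<Rightarrow> complex^3 \<Rightarrow> complex"
  proof -
    obtain K where K: "\<And>a b. norm (p a b) \<le> norm a * norm b * K"
      using bounded_bilinear.bounded[OF p] by blast
    obtain L where L: "\<And>a b. norm (q a b) \<le> norm a * norm b * L"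
      using bounded_bilinear.bounded[OF q] by blast
    have "norm (p a b + q a b) \<le> norm a * norm b * (K + L)" for a b
      using norm_triangle_le[OF add_mono[OF K L]] by (simp add: distrib_left)
    then show ?thesis
      by (intro bounded_bilinear.intro)
         (auto simp: bounded_bilinear.add_left[OF p] bounded_bilinear.add_left[OF q]
            bounded_bilinear.add_right[OF p] bounded_bilinear.add_right[OF q]
            bounded_bilinear.scaleR_left[OF p] bounded_bilinear.scaleR_left[OF q]
            bounded_bilinear.scaleR_right[OF p] bounded_bilinear.scaleR_right[OF q]
            scaleR_add_right)
  qed
  have "bounded_bilinear (\<lambda>(a :: complex^3) (b :: complex^3).
      a $ 1 * cnj (b $ 1) + a $ 2 * cnj (b $ 2) + a $ 3 * cnj (b $ 3))"
    by (intro add comp)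
  moreover have "hdot = (\<lambda>(a :: complex^3) (b :: complex^3).
      a $ 1 * cnj (b $ 1) + a $ 2 * cnj (b $ 2) + a $ 3 * cnj (b $ 3))"
    by (auto simp: hdot_def sum_3 fun_eq_iff)
  ultimately show ?thesis by simp
qed

interpretation hdot: bounded_bilinear hdot
  by (rule bounded_bilinear_hdot)

lemma hdot_cscale_left: "hdot (c *s a) b = c * hdot a b"
  by (simp add: hdot_def sum_distrib_left mult.assoc)

lemma bounded_linear_cscale: "bounded_linear (\<lambda>v :: complex^'n. c *s v)"
proof -
  have "linear (\<lambda>v :: complex^'n. c *s v)"
    by (intro linearI) (auto simp: vec_eq_iff algebra_simps)
  then show ?thesis
    by (simp add: linear_conv_bounded_linear)
qed

lemma L2_on_bounded_linear:
  fixes T :: "'b::euclidean_space \<Rightarrow> 'c::euclidean_space"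
  assumes u: "L2_on D u" and T: "bounded_linear T"
  shows "L2_on D (\<lambda>x. T (u x))"
proof -
  obtain K where K: "\<And>v. norm (T v) \<le> norm v * K"
    using bounded_linear.bounded[OF T] by blast
  have um: "(\<lambda>x. indicator D x *\<^sub>R u x) \<in> borel_measurable lebesgue"
    using u by (simp add: L2_on_def set_borel_measurable_def)
  have ind: "indicator D x *\<^sub>R T (u x) = T (indicator D x *\<^sub>R u x)" for x
    by (simp add: linear_simps(5)[OF T])
  have Tm: "(\<lambda>x. indicator D x *\<^sub>R T (u x)) \<in> borel_measurable lebesgue"
    unfolding ind
    by (rule borel_measurable_continuous_on[OF linear_continuous_on[OF T] um])
  have eq: "indicator D x *\<^sub>R (norm (T (u x)))\<^sup>2 = (norm (indicator D x *\<^sub>R T (u x)))\<^sup>2" for x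
    by (simp add: indicator_def)
  have "integrable lebesgue (\<lambda>x. indicator D x *\<^sub>R (norm (T (u x)))\<^sup>2)"
  proof (rule Bochner_Integration.integrable_bound)
    show "integrable lebesgue (\<lambda>x. K\<^sup>2 * (indicator D x *\<^sub>R (norm (u x))\<^sup>2))"
      using u by (simp add: L2_on_def set_integrable_def)
    show "(\<lambda>x. indicator D x *\<^sub>R (norm (T (u x)))\<^sup>2) \<in> borel_measurable lebesgue"
      unfolding eq using Tm by measurable
    have "(norm (T v))\<^sup>2 \<le> K\<^sup>2 * (norm v)\<^sup>2" for v
      using power_mono[OF K, of v 2] by (simp add: power_mult_distrib mult.commute)
    then show "AE x in lebesgue. norm (indicator D x *\<^sub>R (norm (T (u x)))\<^sup>2)
                 \<le> norm (K\<^sup>2 * (indicator D x *\<^sub>R (norm (u x))\<^sup>2))"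
      by (intro AE_I2) (auto simp: indicator_def)
  qed
  then show ?thesis
    using Tm by (simp add: L2_on_def set_borel_measurable_def set_integrable_def)
qed

lemma L2_on_add:
  assumes u: "L2_on D u" and v: "L2_on D v"
  shows "L2_on D (\<lambda>x. u x + v x)"
proof -
  have m: "(\<lambda>x. indicator D x *\<^sub>R u x + indicator D x *\<^sub>R v x) \<in> borel_measurable lebesgue"
    using u v by (intro borel_measurable_add) (simp_all add: L2_on_def set_borel_measurable_def)
  have eq: "indicator D x *\<^sub>R (norm (u x + v x))\<^sup>2
              = (norm (indicator D x *\<^sub>R u x + indicator D x *\<^sub>R v x))\<^sup>2" for x
    by (simp add: indicator_def)
  have "integrable lebesgue (\<lambda>x. indicator D x *\<^sub>R (norm (u x + v x))\<^sup>2)"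
  proof (rule Bochner_Integration.integrable_bound)
    show "integrable lebesgue (\<lambda>x. 2 * (indicator D x *\<^sub>R (norm (u x))\<^sup>2)
                                   + 2 * (indicator D x *\<^sub>R (norm (v x))\<^sup>2))"
      using u v by (simp add: L2_on_def set_integrable_def)
    show "(\<lambda>x. indicator D x *\<^sub>R (norm (u x + v x))\<^sup>2) \<in> borel_measurable lebesgue"
      unfolding eq using m by measurable
    have "(norm (a + b))\<^sup>2 \<le> 2 * (norm a)\<^sup>2 + 2 * (norm b)\<^sup>2" for a b :: 'a
    proof -
      have "(norm (a + b))\<^sup>2 \<le> (norm a + norm b)\<^sup>2"
        by (intro power_mono norm_triangle_ineq) auto
      also have "\<dots> \<le> 2 * (norm a)\<^sup>2 + 2 * (norm b)\<^sup>2"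
        using sum_squares_bound[of "norm a" "norm b"] by (simp add: power2_sum)
      finally show ?thesis .
    qed
    then show "AE x in lebesgue. norm (indicator D x *\<^sub>R (norm (u x + v x))\<^sup>2)
         \<le> norm (2 * (indicator D x *\<^sub>R (norm (u x))\<^sup>2) + 2 * (indicator D x *\<^sub>R (norm (v x))\<^sup>2))"
      by (intro AE_I2) (auto simp: indicator_def)
  qed
  then show ?thesis
    using m by (simp add: L2_on_def set_borel_measurable_def set_integrable_def scaleR_add_right)
qed

lemma L2_on_subset:
  assumes u: "L2_on D u" and "D' \<in> sets lebesgue" "D' \<subseteq> D"
  shows "L2_on D' u"
proof -
  have "(\<lambda>x. indicator D' x *\<^sub>R (indicator D x *\<^sub>R u x)) \<in> borel_measurable lebesgue"
    by (rule borel_measurable_scaleR)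
       (use u assms(2) in \<open>auto simp: L2_on_def set_borel_measurable_def\<close>)
  moreover have "(\<lambda>x. indicator D' x *\<^sub>R (indicator D x *\<^sub>R u x)) = (\<lambda>x. indicator D' x *\<^sub>R u x)"
    using assms(3) by (auto simp: indicator_def fun_eq_iff split: if_splits)
  ultimately show ?thesis
    using u set_integrable_subset[OF _ assms(2,3)]
    by (auto simp: L2_on_def set_borel_measurable_def)
qed

lemma L2_on_zero: "L2_on D (\<lambda>x. 0)"
  by (simp add: L2_on_def set_borel_measurable_def set_integrable_def)

lemma set_integrable_bounded_bilinear_L2:
  fixes p :: "'b::euclidean_space \<Rightarrow> 'c::euclidean_space \<Rightarrow> 'd::euclidean_space"
  assumes p: "bounded_bilinear p" and u: "L2_on D u" and v: "L2_on D v"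
  shows "set_integrable lebesgue D (\<lambda>x. p (u x) (v x))"
proof -
  interpret p: bounded_bilinear p by (rule p)
  obtain K where K: "K > 0" "\<And>a b. norm (p a b) \<le> norm a * norm b * K"
    using p.pos_bounded by blast
  have um: "(\<lambda>x. indicator D x *\<^sub>R u x) \<in> borel_measurable lebesgue"
    using u by (simp add: L2_on_def set_borel_measurable_def)
  have vm: "(\<lambda>x. indicator D x *\<^sub>R v x) \<in> borel_measurable lebesgue"
    using v by (simp add: L2_on_def set_borel_measurable_def)
  have ind: "indicator D x *\<^sub>R p (u x) (v x)
               = p (indicator D x *\<^sub>R u x) (indicator D x *\<^sub>R v x)" for x
    by (simp add: indicator_def p.zero_left)
  show ?thesis unfolding set_integrable_def
  proof (rule Bochner_Integration.integrable_bound)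
    show "integrable lebesgue (\<lambda>x. K * (indicator D x *\<^sub>R (norm (u x))\<^sup>2)
                                   + K * (indicator D x *\<^sub>R (norm (v x))\<^sup>2))"
      using u v by (simp add: L2_on_def set_integrable_def)
    show "(\<lambda>x. indicator D x *\<^sub>R p (u x) (v x)) \<in> borel_measurable lebesgue"
      unfolding ind
      by (rule borel_measurable_continuous_Pair[OF um vm])
         (intro p.continuous_on continuous_intros)
    have "norm (p a b) \<le> K * (norm a)\<^sup>2 + K * (norm b)\<^sup>2" for a b
    proof -
      have "norm a * norm b \<le> (norm a)\<^sup>2 + (norm b)\<^sup>2"
        using sum_squares_bound[of "norm a" "norm b"] mult_nonneg_nonneg[of "norm a" "norm b"]
        unfolding mult.assoc by (smt (verit) norm_ge_zero)
      then have "norm a * norm b * K \<le> ((norm a)\<^sup>2 + (norm b)\<^sup>2) * K"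
        using K(1) by (intro mult_right_mono) auto
      with K(2)[of a b] show ?thesis by (simp add: algebra_simps)
    qed
    then show "AE x in lebesgue. norm (indicator D x *\<^sub>R p (u x) (v x))
      \<le> norm (K * (indicator D x *\<^sub>R (norm (u x))\<^sup>2) + K * (indicator D x *\<^sub>R (norm (v x))\<^sup>2))"
      using K(1) by (intro AE_I2) (auto simp: indicator_def)
  qed
qed

text \<open>The coefficients are controlled only on the domain and up to null sets: nothing is known
  about the values of a piecewise constant function between its pieces.\<close>

definition ess_bounded_on :: "(real^3) set \<Rightarrow> (real^3 \<Rightarrow> real) \<Rightarrow> bool" where
  "ess_bounded_on D m \<longleftrightarrow>
     set_borel_measurable lebesgue D m \<and> (\<exists>B. AE x in lebesgue. x \<in> D \<longrightarrow> \<bar>m x\<bar> \<le> B)"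

lemma L2_on_ess_bounded_scaleR:
  assumes m: "ess_bounded_on D m" and u: "L2_on D u"
  shows "L2_on D (\<lambda>x. m x *\<^sub>R u x)"
proof -
  obtain B where B: "AE x in lebesgue. x \<in> D \<longrightarrow> \<bar>m x\<bar> \<le> B"
    using m by (auto simp: ess_bounded_on_def)
  have "(\<lambda>x. (indicator D x *\<^sub>R m x) *\<^sub>R (indicator D x *\<^sub>R u x)) \<in> borel_measurable lebesgue"
    by (rule borel_measurable_scaleR)
       (use m u in \<open>simp_all add: L2_on_def ess_bounded_on_def set_borel_measurable_def\<close>)
  moreover have "(\<lambda>x. (indicator D x *\<^sub>R m x) *\<^sub>R (indicator D x *\<^sub>R u x))
                   = (\<lambda>x. indicator D x *\<^sub>R (m x *\<^sub>R u x))"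
    by (auto simp: indicator_def)
  ultimately have mu: "(\<lambda>x. indicator D x *\<^sub>R (m x *\<^sub>R u x)) \<in> borel_measurable lebesgue"
    by simp
  have eq: "indicator D x *\<^sub>R (norm (m x *\<^sub>R u x))\<^sup>2 = (norm (indicator D x *\<^sub>R (m x *\<^sub>R u x)))\<^sup>2" for x
    by (simp add: indicator_def)
  have "integrable lebesgue (\<lambda>x. indicator D x *\<^sub>R (norm (m x *\<^sub>R u x))\<^sup>2)"
  proof (rule Bochner_Integration.integrable_bound)
    show "integrable lebesgue (\<lambda>x. B\<^sup>2 * (indicator D x *\<^sub>R (norm (u x))\<^sup>2))"
      using u by (simp add: L2_on_def set_integrable_def)
    show "(\<lambda>x. indicator D x *\<^sub>R (norm (m x *\<^sub>R u x))\<^sup>2) \<in> borel_measurable lebesgue"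
      unfolding eq using mu by measurable
    show "AE x in lebesgue. norm (indicator D x *\<^sub>R (norm (m x *\<^sub>R u x))\<^sup>2)
            \<le> norm (B\<^sup>2 * (indicator D x *\<^sub>R (norm (u x))\<^sup>2))"
      using B
    proof eventually_elim
      case (elim x)
      have "(m x)\<^sup>2 \<le> B\<^sup>2" if "x \<in> D"
        using elim that power_mono[of "\<bar>m x\<bar>" B 2] by simp
      then show ?case
        by (auto simp: indicator_def power_mult_distrib mult_right_mono)
    qed
  qed
  then show ?thesis
    using mu by (simp add: L2_on_def set_borel_measurable_def set_integrable_def)
qed

lemma ess_bounded_on_const_mult:
  assumes "ess_bounded_on D m"
  shows "ess_bounded_on D (\<lambda>x. c * m x)"
proof -
  obtain B where B: "AE x in lebesgue. x \<in> D \<longrightarrow> \<bar>m x\<bar> \<le> B"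
    using assms by (auto simp: ess_bounded_on_def)
  have "AE x in lebesgue. x \<in> D \<longrightarrow> \<bar>c * m x\<bar> \<le> \<bar>c\<bar> * B"
    using B by eventually_elim (simp add: abs_mult mult_left_mono)
  moreover have "(\<lambda>x. c * (indicator D x *\<^sub>R m x)) \<in> borel_measurable lebesgue"
    using assms by (intro borel_measurable_times)
      (simp_all add: ess_bounded_on_def set_borel_measurable_def)
  ultimately show ?thesis
    unfolding ess_bounded_on_def set_borel_measurable_def by (auto simp: mult.left_commute)
qed

lemma set_integrable_coeff_hdot:
  assumes "ess_bounded_on D m" "L2_on D u" "L2_on D v"
  shows "set_integrable lebesgue D (\<lambda>x. complex_of_real (m x) * hdot (u x) (v x))"
  using set_integrable_bounded_bilinear_L2[OF bounded_bilinear_hdot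
      L2_on_ess_bounded_scaleR[OF assms(1,2)] assms(3)]
  unfolding hdot.scaleR_left unfolding scaleR_conv_of_real .

lemma Linfty_imp_ess_bounded_on:
  assumes "Linfty f" "D \<in> sets lebesgue"
  shows "ess_bounded_on D f"
proof -
  have "set_borel_measurable lebesgue D f"
    using assms unfolding set_borel_measurable_def Linfty_def
    by (intro borel_measurable_scaleR borel_measurable_indicator) auto
  then show ?thesis using assms by (auto simp: Linfty_def ess_bounded_on_def)
qed

lemma piecewise_constant_on_imp_ess_bounded_on:
  assumes f: "piecewise_constant_on D f"
  shows "ess_bounded_on D f"
proof -
  obtain \<D> where fin: "finite \<D>"
    and pieces: "\<And>A. A \<in> \<D> \<Longrightarrow> is_domain A \<and> A \<subseteq> D \<and> f constant_on A"
    and disj: "pairwise disjnt \<D>" and neg: "negligible (D - \<Union>\<D>)"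
    using f unfolding piecewise_constant_on_def by blast
  have "\<exists>c. \<forall>A\<in>\<D>. \<forall>x\<in>A. f x = c A"
    by (rule bchoice) (use pieces in \<open>auto simp: constant_on_def\<close>)
  then obtain c where c: "\<And>A x. A \<in> \<D> \<Longrightarrow> x \<in> A \<Longrightarrow> f x = c A"
    by blast
  have ae: "AE x in lebesgue. x \<notin> D - \<Union>\<D>"
    using neg by (intro AE_not_in) (simp add: negligible_iff_null_sets)
  define g where "g x = (\<Sum>A\<in>\<D>. c A * indicator A x)" for x
  have g: "g x = f x" if "A \<in> \<D>" "x \<in> A" for A x
  proof -
    have "indicator A' x = (0::real)" if "A' \<in> \<D> - {A}" for A'
      using disj that \<open>A \<in> \<D>\<close> \<open>x \<in> A\<close>
      by (auto simp: pairwise_def disjnt_def indicator_def)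
    then have "(\<Sum>A'\<in>\<D> - {A}. c A' * indicator A' x) = 0"
      by (intro sum.neutral) auto
    then show ?thesis
      using that c[OF that] by (simp add: g_def sum.remove[OF fin \<open>A \<in> \<D>\<close>] del: sum_mult_indicator sum_indicator_mult)
  qed
  have g0: "g x = 0" if "x \<notin> \<Union>\<D>" for x
    using that by (auto simp: g_def intro!: sum.neutral)
  have "g \<in> borel_measurable lebesgue"
    unfolding g_def
  proof (intro borel_measurable_sum borel_measurable_times borel_measurable_indicator)
    fix A assume "A \<in> \<D>"
    then show "A \<in> sets lebesgue"
      using pieces by (auto simp: is_domain_def)
  qed auto
  moreover have "AE x in lebesgue. g x = indicator D x *\<^sub>R f x"
    using ae
  proof eventually_elim
    case (elim x)
    show ?case
    proof (cases "x \<in> \<Union>\<D>")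
      case True
      then show ?thesis using g pieces by (fastforce simp: indicator_def)
    next
      case False
      then show ?thesis using g0 elim by (auto simp: indicator_def)
    qed
  qed
  ultimately have "(\<lambda>x. indicator D x *\<^sub>R f x) \<in> borel_measurable lebesgue"
    by (rule borel_measurable_AE)
  moreover have "AE x in lebesgue. x \<in> D \<longrightarrow> \<bar>f x\<bar> \<le> (\<Sum>A\<in>\<D>. \<bar>c A\<bar>)"
    using ae
  proof eventually_elim
    case (elim x)
    show ?case
    proof
      assume "x \<in> D"
      then obtain A where A: "A \<in> \<D>" "x \<in> A" using elim by auto
      then show "\<bar>f x\<bar> \<le> (\<Sum>A\<in>\<D>. \<bar>c A\<bar>)"
        using c[OF A] fin by (auto intro: member_le_sum[of A \<D> "\<lambda>A. \<bar>c A\<bar>"])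
    qed
  qed
  ultimately show ?thesis
    by (auto simp: ess_bounded_on_def set_borel_measurable_def)
qed

lemma piecewise_constant_on_inverse:
  assumes "piecewise_constant_on D f"
  shows "piecewise_constant_on D (\<lambda>x. inverse (f x))"
  using assms unfolding piecewise_constant_on_def constant_on_def by metis

section \<open>Test fields\<close>

lemma integrable_continuous_compact_support:
  fixes g :: "'a::euclidean_space \<Rightarrow> 'b::euclidean_space"
  assumes cont: "continuous_on UNIV g" and K: "compact K" "\<And>x. x \<notin> K \<Longrightarrow> g x = 0"
  shows "integrable lborel g"
proof -
  have "set_integrable lborel K g"
    unfolding set_integrable_def
    using borel_integrable_compact[OF K(1), of g] continuous_on_subset[OF cont] by auto
  moreover have "(\<lambda>x. indicator K x *\<^sub>R g x) = g"
    using K(2) by (auto simp: indicator_def fun_eq_iff)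
  ultimately show ?thesis by (simp add: set_integrable_def)
qed

lemma L2_on_continuous_compact_support:
  fixes g :: "real^3 \<Rightarrow> 'b::euclidean_space"
  assumes cont: "continuous_on UNIV g" and K: "compact K" "\<And>x. x \<notin> K \<Longrightarrow> g x = 0"
    and D: "D \<in> sets lebesgue"
  shows "L2_on D g"
proof -
  have "integrable lborel (\<lambda>x. (norm (g x))\<^sup>2)"
    using K cont by (intro integrable_continuous_compact_support[of _ K] continuous_intros) auto
  then have "integrable lebesgue (\<lambda>x. (norm (g x))\<^sup>2)"
    by (subst integrable_completion) auto
  then have "set_integrable lebesgue D (\<lambda>x. (norm (g x))\<^sup>2)"
    unfolding set_integrable_def by (intro integrable_mult_indicator D)
  moreover have "g \<in> borel_measurable borel"
    using cont by (rule borel_measurable_continuous_onI)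
  then have "g \<in> borel_measurable lebesgue"
    by (simp add: measurable_completion)
  then have "set_borel_measurable lebesgue D g"
    unfolding set_borel_measurable_def
    using D by (intro borel_measurable_scaleR borel_measurable_indicator)
  ultimately show ?thesis by (simp add: L2_on_def)
qed

lemma zero_outside_supp: "x \<notin> supp f \<Longrightarrow> f x = 0"
  using closure_subset[of "{x. f x \<noteq> 0}"] by (auto simp: supp_def)

lemma frechet_derivative_zero_outside:
  fixes f :: "'a::euclidean_space \<Rightarrow> 'b::real_normed_vector"
  assumes K: "closed K" "\<And>x. x \<notin> K \<Longrightarrow> f x = 0" and x: "x \<notin> K"
  shows "frechet_derivative f (at x) v = 0"
proof -
  have "(f has_derivative (\<lambda>_. 0)) (at x)"
  proof (rule has_derivative_transform_within_open[of "\<lambda>_. 0" _ _ _ "- K"])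
    show "((\<lambda>_. 0 :: 'b) has_derivative (\<lambda>_. 0)) (at x)"
      by (rule has_derivative_const)
  qed (use assms in auto)
  then have "frechet_derivative f (at x) = (\<lambda>_. 0)"
    using frechet_derivative_at by metis
  then show ?thesis by simp
qed

lemma test_functionsD:
  assumes "\<Phi> \<in> test_functions D"
  shows "\<Phi> differentiable (at x)"
    and "continuous_on UNIV \<Phi>"
    and "continuous_on UNIV (\<lambda>x. frechet_derivative \<Phi> (at x) v)"
    and "compact (supp \<Phi>)"
    and "x \<notin> supp \<Phi> \<Longrightarrow> frechet_derivative \<Phi> (at x) v = 0"
proof -
  have "k_times_cont_diff (Suc 0) \<Phi>"
    using assms unfolding test_functions_def smooth_fun_def by blast
  then have d: "\<And>x. \<Phi> differentiable (at x)"
    and c: "\<And>v. continuous_on UNIV (\<lambda>x. frechet_derivative \<Phi> (at x) v)"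
    by auto
  show "\<Phi> differentiable (at x)" by (rule d)
  show "continuous_on UNIV \<Phi>"
    by (intro differentiable_imp_continuous_on differentiable_at_imp_differentiable_on d)
  show "continuous_on UNIV (\<lambda>x. frechet_derivative \<Phi> (at x) v)" by (rule c)
  show "compact (supp \<Phi>)"
    using assms by (simp add: test_functions_def compactly_supported_in_def)
  show "x \<notin> supp \<Phi> \<Longrightarrow> frechet_derivative \<Phi> (at x) v = 0"
    by (rule frechet_derivative_zero_outside[of "supp \<Phi>"])
       (auto simp: zero_outside_supp, simp add: supp_def)
qed

lemma has_derivative_test_component:
  assumes "\<Phi> \<in> test_functions D"
  shows "((\<lambda>y. \<Phi> y $ k) has_derivative (\<lambda>v. frechet_derivative \<Phi> (at x) v $ k)) (at x)"
  using test_functionsD(1)[OF assms, of x]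
  by (intro bounded_linear.has_derivative[OF bounded_linear_vec_nth])
     (simp add: frechet_derivative_works)

lemma partial_test_component:
  assumes "\<Phi> \<in> test_functions D"
  shows "partial i (\<lambda>y. \<Phi> y $ k) x = frechet_derivative \<Phi> (at x) (axis i 1) $ k"
  using frechet_derivative_at[OF has_derivative_test_component[OF assms, of k x]]
  by (simp add: partial_def fun_eq_iff)

lemma L2_on_test_function:
  fixes \<Phi> :: "real^3 \<Rightarrow> complex^3"
  assumes "\<Phi> \<in> test_functions S" "D \<in> sets lebesgue"
  shows "L2_on D \<Phi>"
  using test_functionsD(2,4)[OF assms(1)] assms(2)
  by (intro L2_on_continuous_compact_support[of _ "supp \<Phi>"]) (auto simp: zero_outside_supp)

lemma continuous_on_curl_test_function:
  assumes \<Phi>: "\<Phi> \<in> test_functions S"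
  shows "continuous_on UNIV (curl \<Phi>)"
proof -
  have "continuous_on UNIV (\<lambda>x. \<chi> i. curl \<Phi> x $ i)"
  proof (rule continuous_on_vec_lambda)
    fix i :: 3
    show "continuous_on UNIV (\<lambda>x. curl \<Phi> x $ i)"
      using exhaust_3[of i] unfolding curl_def partial_test_component[OF \<Phi>]
      by (elim disjE; simp; intro continuous_on_diff continuous_on_component test_functionsD(3)[OF \<Phi>])
  qed
  then show ?thesis by simp
qed

lemma L2_on_curl_test_function:
  assumes \<Phi>: "\<Phi> \<in> test_functions S" and D: "D \<in> sets lebesgue"
  shows "L2_on D (curl \<Phi>)"
proof (rule L2_on_continuous_compact_support[of _ "supp \<Phi>"])
  show "curl \<Phi> x = 0" if "x \<notin> supp \<Phi>" for x
    unfolding curl_def partial_test_component[OF \<Phi>]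
    using test_functionsD(5)[OF \<Phi> that] by (simp add: vec_eq_iff forall_3)
qed (use test_functionsD(4)[OF \<Phi>] continuous_on_curl_test_function[OF \<Phi>] D in auto)

lemma L2_on_divergence_test_function:
  assumes \<Phi>: "\<Phi> \<in> test_functions S" and D: "D \<in> sets lebesgue"
  shows "L2_on D (divergence \<Phi>)"
proof (rule L2_on_continuous_compact_support[of _ "supp \<Phi>"])
  show "continuous_on UNIV (divergence \<Phi>)"
    unfolding divergence_def partial_test_component[OF \<Phi>]
    by (intro continuous_on_sum continuous_on_component test_functionsD(3)[OF \<Phi>])
  show "divergence \<Phi> x = 0" if "x \<notin> supp \<Phi>" for x
    unfolding divergence_def partial_test_component[OF \<Phi>]
    using test_functionsD(5)[OF \<Phi> that] by simp
qed (use test_functionsD(4)[OF \<Phi>] D in auto)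

section \<open>Linearity of traces and function spaces\<close>

lemma set_integral_add_mult:
  fixes f g :: "'a \<Rightarrow> complex"
  assumes "set_integrable M A f" "set_integrable M A g"
  shows "(LINT x:A|M. f x + c * g x) = (LINT x:A|M. f x) + c * (LINT x:A|M. g x)"
  using assms by simp

lemma L2_on_add_cscale:
  fixes u v :: "real^3 \<Rightarrow> complex^'n"
  assumes "L2_on D u" "L2_on D v"
  shows "L2_on D (\<lambda>x. u x + c *s v x)"
  by (intro L2_on_add assms L2_on_bounded_linear[OF _ bounded_linear_cscale])

lemma L2_on_add_mult:
  fixes u v :: "real^3 \<Rightarrow> complex"
  assumes "L2_on D u" "L2_on D v"
  shows "L2_on D (\<lambda>x. u x + c * v x)"
  by (intro L2_on_add assms L2_on_bounded_linear[OF _ bounded_linear_mult_right])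

lemma tangential_trace_add_cscale:
  assumes D: "D \<in> sets lebesgue" and \<Phi>: "\<Phi> \<in> test_functions S"
    and "L2_on D u" "L2_on D w" "L2_on D v" "L2_on D z"
  shows "tangential_trace D (\<lambda>x. u x + c *s v x) (\<lambda>x. w x + c *s z x) \<Phi>
           = tangential_trace D u w \<Phi> + c * tangential_trace D v z \<Phi>"
proof -
  have int: "set_integrable lebesgue D (\<lambda>x. hdot (w x) (\<Phi> x) - hdot (u x) (curl \<Phi> x))"
    if "L2_on D u" "L2_on D w" for u w
    by (intro set_integral_diff set_integrable_bounded_bilinear_L2[OF bounded_bilinear_hdot] that
          L2_on_test_function[OF \<Phi> D] L2_on_curl_test_function[OF \<Phi> D])
  show ?thesis
    unfolding tangential_trace_def set_integral_add_mult[OF int int, OF assms(3-6), symmetric]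
    by (simp add: hdot.add_left hdot_cscale_left algebra_simps)
qed

text \<open>A weak curl is characterised by the vanishing of Green's formula for compactly supported test
  fields, so linearity of the curl and of the trace are the same fact.\<close>

lemma weak_curl_on_iff_tangential_trace:
  assumes D: "D \<in> sets lebesgue" and "L2_on D u" "L2_on D w"
  shows "weak_curl_on D u w \<longleftrightarrow> (\<forall>\<Phi>\<in>test_functions D. tangential_trace D u w \<Phi> = 0)"
proof -
  have "tangential_trace D u w \<Phi>
      = (LINT x:D|lebesgue. hdot (w x) (\<Phi> x)) - (LINT x:D|lebesgue. hdot (u x) (curl \<Phi> x))"
    if "\<Phi> \<in> test_functions D" for \<Phi>
    unfolding tangential_trace_def
    by (intro set_integral_diff set_integrable_bounded_bilinear_L2[OF bounded_bilinear_hdot] assms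
          L2_on_test_function[OF that D] L2_on_curl_test_function[OF that D])
  then show ?thesis by (auto simp: weak_curl_on_def)
qed

lemma Hcurl_add_cscale:
  assumes D: "D \<in> sets lebesgue" and u: "Hcurl D u w" and v: "Hcurl D v z"
  shows "Hcurl D (\<lambda>x. u x + c *s v x) (\<lambda>x. w x + c *s z x)"
proof -
  have L2: "L2_on D u" "L2_on D w" "L2_on D v" "L2_on D z"
    using u v by (auto simp: Hcurl_def)
  note L2' = L2_on_add_cscale[OF L2(1,3), of c] L2_on_add_cscale[OF L2(2,4), of c]
  have "weak_curl_on D (\<lambda>x. u x + c *s v x) (\<lambda>x. w x + c *s z x)"
    using u v
    by (simp add: Hcurl_def weak_curl_on_iff_tangential_trace[OF D] L2 L2'
          tangential_trace_add_cscale[OF D _ L2])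
  then show ?thesis using L2' by (simp add: Hcurl_def)
qed

lemma boundary_test_fieldsD: "\<Phi> \<in> boundary_test_fields D S \<Longrightarrow> \<Phi> \<in> test_functions UNIV"
  by (simp add: boundary_test_fields_def)

lemma tangential_trace_eq_add_cscale:
  assumes D: "D \<in> sets lebesgue"
    and u: "tangential_trace_eq D S u u'" and v: "tangential_trace_eq D S v v'"
  shows "tangential_trace_eq D S (\<lambda>x. u x + c *s v x) (\<lambda>x. u' x + c *s v' x)"
proof -
  obtain w w' where w: "Hcurl D u w" "Hcurl D u' w'"
      "\<And>\<Phi>. \<Phi>\<in>boundary_test_fields D S \<Longrightarrow> tangential_trace D u w \<Phi> = tangential_trace D u' w' \<Phi>"
    using u unfolding tangential_trace_eq_def by blast
  obtain z z' where z: "Hcurl D v z" "Hcurl D v' z'"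
      "\<And>\<Phi>. \<Phi>\<in>boundary_test_fields D S \<Longrightarrow> tangential_trace D v z \<Phi> = tangential_trace D v' z' \<Phi>"
    using v unfolding tangential_trace_eq_def by blast
  have L2: "L2_on D u" "L2_on D w" "L2_on D v" "L2_on D z"
       "L2_on D u'" "L2_on D w'" "L2_on D v'" "L2_on D z'"
    using w z by (auto simp: Hcurl_def)
  show ?thesis
    unfolding tangential_trace_eq_def
  proof (intro exI conjI ballI)
    show "Hcurl D (\<lambda>x. u x + c *s v x) (\<lambda>x. w x + c *s z x)"
      by (rule Hcurl_add_cscale[OF D w(1) z(1)])
    show "Hcurl D (\<lambda>x. u' x + c *s v' x) (\<lambda>x. w' x + c *s z' x)"
      by (rule Hcurl_add_cscale[OF D w(2) z(2)])
    fix \<Phi> assume \<Phi>: "\<Phi> \<in> boundary_test_fields D S"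
    note T = tangential_trace_add_cscale[OF D boundary_test_fieldsD[OF \<Phi>]]
    show "tangential_trace D (\<lambda>x. u x + c *s v x) (\<lambda>x. w x + c *s z x) \<Phi>
        = tangential_trace D (\<lambda>x. u' x + c *s v' x) (\<lambda>x. w' x + c *s z' x) \<Phi>"
      by (simp add: T[OF L2(1-4)] T[OF L2(5-8)] w(3)[OF \<Phi>] z(3)[OF \<Phi>])
  qed
qed

lemma Hcurl_Gamma_add_cscale:
  assumes D: "\<Omega> \<in> sets lebesgue" and "Hcurl_Gamma \<Omega> \<Gamma> u w" "Hcurl_Gamma \<Omega> \<Gamma> v z"
  shows "Hcurl_Gamma \<Omega> \<Gamma> (\<lambda>x. u x + c *s v x) (\<lambda>x. w x + c *s z x)"
  using assms Hcurl_add_cscale[OF D, of u w v z c]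
    tangential_trace_eq_add_cscale[OF D, of _ u "\<lambda>_. 0" v "\<lambda>_. 0" c]
  by (simp add: Hcurl_Gamma_def)

lemma normal_trace_add_cscale:
  assumes D: "D \<in> sets lebesgue" and \<Phi>: "\<Phi> \<in> test_functions S"
    and "L2_on D u" "L2_on D g" "L2_on D v" "L2_on D h"
  shows "normal_trace D (\<lambda>x. u x + c * v x) (\<lambda>x. g x + c *s h x) \<Phi>
           = normal_trace D u g \<Phi> + c * normal_trace D v h \<Phi>"
proof -
  have int: "set_integrable lebesgue D (\<lambda>x. hdot (g x) (\<Phi> x) + u x * cnj (divergence \<Phi> x))"
    if "L2_on D u" "L2_on D g" for u g
    by (intro set_integral_add set_integrable_bounded_bilinear_L2[OF bounded_bilinear_hdot]
          set_integrable_bounded_bilinear_L2[OF bounded_bilinear_mult_cnj] that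
          L2_on_test_function[OF \<Phi> D] L2_on_divergence_test_function[OF \<Phi> D])
  show ?thesis
    unfolding normal_trace_def set_integral_add_mult[OF int int, OF assms(3-6), symmetric]
    by (simp add: hdot.add_left hdot_cscale_left algebra_simps)
qed

lemma weak_gradient_on_iff_normal_trace:
  assumes D: "D \<in> sets lebesgue" and "L2_on D v" "L2_on D g"
  shows "weak_gradient_on D v g \<longleftrightarrow> (\<forall>\<Phi>\<in>test_functions D. normal_trace D v g \<Phi> = 0)"
proof -
  have "normal_trace D v g \<Phi>
      = (LINT x:D|lebesgue. hdot (g x) (\<Phi> x)) + (LINT x:D|lebesgue. v x * cnj (divergence \<Phi> x))"
    if "\<Phi> \<in> test_functions D" for \<Phi>
    unfolding normal_trace_def
    by (intro set_integral_add set_integrable_bounded_bilinear_L2[OF bounded_bilinear_hdot] assms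
          set_integrable_bounded_bilinear_L2[OF bounded_bilinear_mult_cnj]
          L2_on_test_function[OF that D] L2_on_divergence_test_function[OF that D])
  then show ?thesis by (auto simp: weak_gradient_on_def eq_neg_iff_add_eq_0)
qed

lemma H1_Gamma_add_cscale:
  assumes D: "D \<in> sets lebesgue" and u: "H1_Gamma D \<Gamma> u g" and v: "H1_Gamma D \<Gamma> v h"
  shows "H1_Gamma D \<Gamma> (\<lambda>x. u x + c * v x) (\<lambda>x. g x + c *s h x)"
proof -
  have L2: "L2_on D u" "L2_on D g" "L2_on D v" "L2_on D h"
    using u v by (auto simp: H1_Gamma_def H1_def)
  note L2' = L2_on_add_mult[OF L2(1,3), of c] L2_on_add_cscale[OF L2(2,4), of c]
  show ?thesis
    using u v
    by (simp add: H1_Gamma_def H1_def weak_gradient_on_iff_normal_trace[OF D] L2 L2'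
          normal_trace_add_cscale[OF D _ L2] normal_trace_add_cscale[OF D boundary_test_fieldsD L2])
qed

lemma H1_Gamma_zero: "H1_Gamma D \<Gamma> (\<lambda>_. 0) (\<lambda>_. 0)"
  by (simp add: H1_Gamma_def H1_def L2_on_zero weak_gradient_on_def normal_trace_def hdot.zero_left)

section \<open>The weak problem: linearity, sources and uniqueness\<close>

text \<open>The bounds on the coefficients make every term of the variational equation integrable. The
  conductivity stays a parameter of the lemmas because two different ones have to be compared.\<close>

locale eddy_current_problem =
  fixes \<Omega> \<Omega>0 \<Gamma> :: "(real^3) set" and \<mu> \<epsilon> :: "real^3 \<Rightarrow> real" and \<omega> :: real
  assumes Omega_sets: "\<Omega> \<in> sets lebesgue" and Omega0_sets: "\<Omega>0 \<in> sets lebesgue"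
    and Omega0_subset: "\<Omega>0 \<subseteq> \<Omega>"
    and inverse_mu: "ess_bounded_on \<Omega> (\<lambda>x. inverse (\<mu> x))"
    and eps: "ess_bounded_on \<Omega>0 \<epsilon>"
begin

lemma curl_form_add_cscale:
  assumes \<kappa>: "ess_bounded_on \<Omega> \<kappa>"
    and L2: "L2_on \<Omega> E" "L2_on \<Omega> w" "L2_on \<Omega> E'" "L2_on \<Omega> w'" "L2_on \<Omega> F" "L2_on \<Omega> z"
  shows "(LINT x:\<Omega>|lebesgue. complex_of_real (inverse (\<mu> x)) * hdot (w x + c *s w' x) (z x)
            - \<i> * complex_of_real (\<omega> * \<kappa> x) * hdot (E x + c *s E' x) (F x))
       = (LINT x:\<Omega>|lebesgue. complex_of_real (inverse (\<mu> x)) * hdot (w x) (z x)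
            - \<i> * complex_of_real (\<omega> * \<kappa> x) * hdot (E x) (F x))
       + c * (LINT x:\<Omega>|lebesgue. complex_of_real (inverse (\<mu> x)) * hdot (w' x) (z x)
            - \<i> * complex_of_real (\<omega> * \<kappa> x) * hdot (E' x) (F x))"
proof -
  have int: "set_integrable lebesgue \<Omega> (\<lambda>x. complex_of_real (inverse (\<mu> x)) * hdot (w x) (z x)
            - \<i> * complex_of_real (\<omega> * \<kappa> x) * hdot (E x) (F x))"
    if "L2_on \<Omega> E" "L2_on \<Omega> w" for E w
    unfolding mult.assoc
    by (intro set_integral_diff set_integrable_mult_right set_integrable_coeff_hdot
          ess_bounded_on_const_mult[OF \<kappa>] inverse_mu that L2(5,6))
  show ?thesis
    unfolding set_integral_add_mult[OF int int, OF L2(1-4), symmetric]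
    by (simp add: hdot.add_left hdot_cscale_left algebra_simps)
qed

lemma coeff_integral_add_cscale:
  assumes "ess_bounded_on D m" "L2_on D u" "L2_on D v" "L2_on D F"
  shows "(LINT x:D|lebesgue. complex_of_real (m x) * hdot (u x + c *s v x) (F x))
     = (LINT x:D|lebesgue. complex_of_real (m x) * hdot (u x) (F x))
     + c * (LINT x:D|lebesgue. complex_of_real (m x) * hdot (v x) (F x))"
  unfolding set_integral_add_mult[OF set_integrable_coeff_hdot set_integrable_coeff_hdot,
      OF assms(1,2,4) assms(1,3,4), symmetric]
  by (simp add: hdot.add_left hdot_cscale_left algebra_simps)

lemma weak_solution_add_cscale:
  assumes \<kappa>: "ess_bounded_on \<Omega> \<kappa>" and f: "L2_on \<Omega> f" and g: "L2_on \<Omega> g"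
    and E: "weak_solution \<Omega> \<Omega>0 \<Gamma> \<mu> \<epsilon> \<omega> \<kappa> f E"
    and E': "weak_solution \<Omega> \<Omega>0 \<Gamma> \<mu> \<epsilon> \<omega> \<kappa> g E'"
  shows "weak_solution \<Omega> \<Omega>0 \<Gamma> \<mu> \<epsilon> \<omega> \<kappa> (\<lambda>x. f x + c *s g x) (\<lambda>x. E x + c *s E' x)"
proof -
  obtain w \<phi> p where Ew: "Hcurl_Gamma \<Omega> \<Gamma> E w" and \<phi>: "H1_Gamma \<Omega>0 \<Gamma> \<phi> p"
    and eq: "\<And>F z. Hcurl_Gamma \<Omega> \<Gamma> F z \<Longrightarrow>
           (LINT x:\<Omega>|lebesgue. complex_of_real (inverse (\<mu> x)) * hdot (w x) (z x)
                              - \<i> * complex_of_real (\<omega> * \<kappa> x) * hdot (E x) (F x))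
           + (LINT x:\<Omega>0|lebesgue. complex_of_real (\<epsilon> x) * hdot (p x) (F x))
           = (LINT x:\<Omega>|lebesgue. hdot (f x) (F x))"
    and dv: "\<And>\<psi> q. H1_Gamma \<Omega>0 \<Gamma> \<psi> q \<Longrightarrow>
           (LINT x:\<Omega>0|lebesgue. complex_of_real (\<epsilon> x) * hdot (E x) (q x)) = 0"
    using E unfolding weak_solution_def by blast
  obtain w' \<phi>' p' where Ew': "Hcurl_Gamma \<Omega> \<Gamma> E' w'" and \<phi>': "H1_Gamma \<Omega>0 \<Gamma> \<phi>' p'"
    and eq': "\<And>F z. Hcurl_Gamma \<Omega> \<Gamma> F z \<Longrightarrow>
           (LINT x:\<Omega>|lebesgue. complex_of_real (inverse (\<mu> x)) * hdot (w' x) (z x)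
                              - \<i> * complex_of_real (\<omega> * \<kappa> x) * hdot (E' x) (F x))
           + (LINT x:\<Omega>0|lebesgue. complex_of_real (\<epsilon> x) * hdot (p' x) (F x))
           = (LINT x:\<Omega>|lebesgue. hdot (g x) (F x))"
    and dv': "\<And>\<psi> q. H1_Gamma \<Omega>0 \<Gamma> \<psi> q \<Longrightarrow>
           (LINT x:\<Omega>0|lebesgue. complex_of_real (\<epsilon> x) * hdot (E' x) (q x)) = 0"
    using E' unfolding weak_solution_def by blast
  have L2: "L2_on \<Omega> E" "L2_on \<Omega> w" "L2_on \<Omega> E'" "L2_on \<Omega> w'"
    using Ew Ew' by (auto simp: Hcurl_Gamma_def Hcurl_def)
  have L2p: "L2_on \<Omega>0 p" "L2_on \<Omega>0 p'"
    using \<phi> \<phi>' by (auto simp: H1_Gamma_def H1_def)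
  have L2E: "L2_on \<Omega>0 E" "L2_on \<Omega>0 E'"
    using L2 L2_on_subset[OF _ Omega0_sets Omega0_subset] by auto
  show ?thesis
    unfolding weak_solution_def
  proof (intro exI conjI allI impI)
    show "Hcurl_Gamma \<Omega> \<Gamma> (\<lambda>x. E x + c *s E' x) (\<lambda>x. w x + c *s w' x)"
      by (rule Hcurl_Gamma_add_cscale[OF Omega_sets Ew Ew'])
    show "H1_Gamma \<Omega>0 \<Gamma> (\<lambda>x. \<phi> x + c * \<phi>' x) (\<lambda>x. p x + c *s p' x)"
      by (rule H1_Gamma_add_cscale[OF Omega0_sets \<phi> \<phi>'])
  next
    fix F z assume Fz: "Hcurl_Gamma \<Omega> \<Gamma> F z"
    then have F: "L2_on \<Omega> F" "L2_on \<Omega> z" by (auto simp: Hcurl_Gamma_def Hcurl_def)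
    have F0: "L2_on \<Omega>0 F" using F(1) L2_on_subset[OF _ Omega0_sets Omega0_subset] by auto
    have "(LINT x:\<Omega>|lebesgue. hdot (f x + c *s g x) (F x))
        = (LINT x:\<Omega>|lebesgue. hdot (f x) (F x)) + c * (LINT x:\<Omega>|lebesgue. hdot (g x) (F x))"
      unfolding set_integral_add_mult[OF set_integrable_bounded_bilinear_L2
          set_integrable_bounded_bilinear_L2, OF bounded_bilinear_hdot f F(1)
          bounded_bilinear_hdot g F(1), symmetric]
      by (simp add: hdot.add_left hdot_cscale_left)
    note rhs = this
    show "(LINT x:\<Omega>|lebesgue. complex_of_real (inverse (\<mu> x)) * hdot (w x + c *s w' x) (z x)
            - \<i> * complex_of_real (\<omega> * \<kappa> x) * hdot (E x + c *s E' x) (F x))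
         + (LINT x:\<Omega>0|lebesgue. complex_of_real (\<epsilon> x) * hdot (p x + c *s p' x) (F x))
         = (LINT x:\<Omega>|lebesgue. hdot (f x + c *s g x) (F x))"
      unfolding curl_form_add_cscale[OF \<kappa> L2 F] coeff_integral_add_cscale[OF eps L2p F0]
        rhs eq[OF Fz, symmetric] eq'[OF Fz, symmetric]
      by (simp only: distrib_left ac_simps)
  next
    fix \<psi> q assume q: "H1_Gamma \<Omega>0 \<Gamma> \<psi> q"
    then have "L2_on \<Omega>0 q" by (auto simp: H1_Gamma_def H1_def)
    then show "(LINT x:\<Omega>0|lebesgue. complex_of_real (\<epsilon> x) * hdot (E x + c *s E' x) (q x)) = 0"
      using coeff_integral_add_cscale[OF eps L2E] dv[OF q] dv'[OF q] by simp
  qed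
qed

text \<open>A perturbation of the conductivity acts as a source that depends on the solution; this is what
  turns the inverse conductivity problem into an inverse source problem.\<close>

lemma weak_solution_conductivity_to_source:
  assumes \<kappa>: "ess_bounded_on \<Omega> \<kappa>" and \<sigma>: "ess_bounded_on \<Omega> \<sigma>" and f: "L2_on \<Omega> f"
    and E: "weak_solution \<Omega> \<Omega>0 \<Gamma> \<mu> \<epsilon> \<omega> (\<lambda>x. \<kappa> x + \<sigma> x) f E"
  shows "weak_solution \<Omega> \<Omega>0 \<Gamma> \<mu> \<epsilon> \<omega> \<kappa> (\<lambda>x. f x + (\<i> * complex_of_real (\<omega> * \<sigma> x)) *s E x) E"
proof -
  obtain w \<phi> p where Ew: "Hcurl_Gamma \<Omega> \<Gamma> E w" and \<phi>: "H1_Gamma \<Omega>0 \<Gamma> \<phi> p"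
    and eq: "\<And>F z. Hcurl_Gamma \<Omega> \<Gamma> F z \<Longrightarrow>
           (LINT x:\<Omega>|lebesgue. complex_of_real (inverse (\<mu> x)) * hdot (w x) (z x)
                              - \<i> * complex_of_real (\<omega> * (\<kappa> x + \<sigma> x)) * hdot (E x) (F x))
           + (LINT x:\<Omega>0|lebesgue. complex_of_real (\<epsilon> x) * hdot (p x) (F x))
           = (LINT x:\<Omega>|lebesgue. hdot (f x) (F x))"
    and dv: "\<And>\<psi> q. H1_Gamma \<Omega>0 \<Gamma> \<psi> q \<Longrightarrow>
           (LINT x:\<Omega>0|lebesgue. complex_of_real (\<epsilon> x) * hdot (E x) (q x)) = 0"
    using E unfolding weak_solution_def by blast
  have L2: "L2_on \<Omega> E" "L2_on \<Omega> w"
    using Ew by (auto simp: Hcurl_Gamma_def Hcurl_def)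
  show ?thesis
    unfolding weak_solution_def
  proof (intro exI conjI allI impI)
    fix F z assume Fz: "Hcurl_Gamma \<Omega> \<Gamma> F z"
    then have F: "L2_on \<Omega> F" "L2_on \<Omega> z" by (auto simp: Hcurl_Gamma_def Hcurl_def)
    have i1: "set_integrable lebesgue \<Omega> (\<lambda>x. complex_of_real (inverse (\<mu> x)) * hdot (w x) (z x)
            - \<i> * complex_of_real (\<omega> * \<kappa> x) * hdot (E x) (F x))"
      unfolding mult.assoc
      by (intro set_integral_diff set_integrable_mult_right set_integrable_coeff_hdot
            ess_bounded_on_const_mult[OF \<kappa>] inverse_mu L2 F)
    have i2: "set_integrable lebesgue \<Omega> (\<lambda>x. complex_of_real (\<omega> * \<sigma> x) * hdot (E x) (F x))"
      by (intro set_integrable_coeff_hdot ess_bounded_on_const_mult[OF \<sigma>] L2 F)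
    have i3: "set_integrable lebesgue \<Omega> (\<lambda>x. hdot (f x) (F x))"
      by (intro set_integrable_bounded_bilinear_L2[OF bounded_bilinear_hdot] f F)
    have "(LINT x:\<Omega>|lebesgue. complex_of_real (inverse (\<mu> x)) * hdot (w x) (z x)
            - \<i> * complex_of_real (\<omega> * (\<kappa> x + \<sigma> x)) * hdot (E x) (F x))
        = (LINT x:\<Omega>|lebesgue. complex_of_real (inverse (\<mu> x)) * hdot (w x) (z x)
            - \<i> * complex_of_real (\<omega> * \<kappa> x) * hdot (E x) (F x))
          + (- \<i>) * (LINT x:\<Omega>|lebesgue. complex_of_real (\<omega> * \<sigma> x) * hdot (E x) (F x))"
      unfolding set_integral_add_mult[OF i1 i2, symmetric]
      by (intro arg_cong[of _ _ "set_lebesgue_integral lebesgue \<Omega>"] ext) (simp add: algebra_simps)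
    moreover have "(LINT x:\<Omega>|lebesgue. hdot (f x + (\<i> * complex_of_real (\<omega> * \<sigma> x)) *s E x) (F x))
        = (LINT x:\<Omega>|lebesgue. hdot (f x) (F x))
          + \<i> * (LINT x:\<Omega>|lebesgue. complex_of_real (\<omega> * \<sigma> x) * hdot (E x) (F x))"
      unfolding set_integral_add_mult[OF i3 i2, symmetric]
      by (simp add: hdot.add_left hdot_cscale_left algebra_simps)
    ultimately show "(LINT x:\<Omega>|lebesgue. complex_of_real (inverse (\<mu> x)) * hdot (w x) (z x)
            - \<i> * complex_of_real (\<omega> * \<kappa> x) * hdot (E x) (F x))
         + (LINT x:\<Omega>0|lebesgue. complex_of_real (\<epsilon> x) * hdot (p x) (F x))
         = (LINT x:\<Omega>|lebesgue. hdot (f x + (\<i> * complex_of_real (\<omega> * \<sigma> x)) *s E x) (F x))"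
      unfolding eq[OF Fz, symmetric] by simp
  qed (use Ew \<phi> dv in auto)
qed

text \<open>For a curl-free field that vanishes in the air region, only the conduction term of the
  variational equation survives, and the multiplier can be taken to be zero.\<close>

lemma weak_solution_curl_free:
  assumes \<delta>: "Hcurl_Gamma \<Omega> \<Gamma> \<delta> (\<lambda>_. 0)" and air: "\<And>x. x \<in> \<Omega>0 \<Longrightarrow> \<delta> x = 0"
  shows "weak_solution \<Omega> \<Omega>0 \<Gamma> \<mu> \<epsilon> \<omega> \<kappa> (\<lambda>x. - ((\<i> * complex_of_real (\<omega> * \<kappa> x)) *s \<delta> x)) \<delta>"
  unfolding weak_solution_def
proof (intro exI conjI allI impI)
  show "Hcurl_Gamma \<Omega> \<Gamma> \<delta> (\<lambda>_. 0)" by (rule \<delta>)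
  show "H1_Gamma \<Omega>0 \<Gamma> (\<lambda>_. 0) (\<lambda>_. 0)" by (rule H1_Gamma_zero)
  fix \<psi> q
  have "(LINT x:\<Omega>0|lebesgue. complex_of_real (\<epsilon> x) * hdot (\<delta> x) (q x))
      = (LINT x:\<Omega>0|lebesgue. 0)"
    using air by (intro set_lebesgue_integral_cong Omega0_sets) (simp add: hdot.zero_left)
  then show "(LINT x:\<Omega>0|lebesgue. complex_of_real (\<epsilon> x) * hdot (\<delta> x) (q x)) = 0"
    by simp
qed (simp add: hdot.zero_left hdot.minus_left hdot_cscale_left)

text \<open>If \<open>E'\<close> and \<open>E''\<close> both have source \<open>g\<close>, then \<open>E + E'' - E'\<close> has the source \<open>f\<close> of \<open>E\<close>, hence
  equals \<open>E\<close>. In this way uniqueness for one source yields it for all sources.\<close>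

lemma is_the_solution_other_source:
  assumes \<kappa>: "ess_bounded_on \<Omega> \<kappa>" and f: "L2_on \<Omega> f" and g: "L2_on \<Omega> g"
    and E: "is_the_solution \<Omega> \<Omega>0 \<Gamma> \<mu> \<epsilon> \<omega> \<kappa> f E"
    and E': "weak_solution \<Omega> \<Omega>0 \<Gamma> \<mu> \<epsilon> \<omega> \<kappa> g E'"
  shows "is_the_solution \<Omega> \<Omega>0 \<Gamma> \<mu> \<epsilon> \<omega> \<kappa> g E'"
  unfolding is_the_solution_def
proof (intro conjI allI impI)
  fix E'' assume E'': "weak_solution \<Omega> \<Omega>0 \<Gamma> \<mu> \<epsilon> \<omega> \<kappa> g E''"
  have "weak_solution \<Omega> \<Omega>0 \<Gamma> \<mu> \<epsilon> \<omega> \<kappa>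
      (\<lambda>x. (f x + 1 *s g x) + (- 1) *s g x) (\<lambda>x. (E x + 1 *s E'' x) + (- 1) *s E' x)"
    using E E' E'' unfolding is_the_solution_def
    by (intro weak_solution_add_cscale L2_on_add_cscale \<kappa> f g) auto
  moreover have "(\<lambda>x. (f x + 1 *s g x) + (- 1) *s g x) = f"
    by (simp add: vec_eq_iff fun_eq_iff)
  ultimately have "weak_solution \<Omega> \<Omega>0 \<Gamma> \<mu> \<epsilon> \<omega> \<kappa> f (\<lambda>x. (E x + 1 *s E'' x) + (- 1) *s E' x)"
    by (simp only:)
  moreover have "AE x in lebesgue. x \<in> \<Omega> \<longrightarrow> G x = E x"
    if "weak_solution \<Omega> \<Omega>0 \<Gamma> \<mu> \<epsilon> \<omega> \<kappa> f G" for G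
    using E that unfolding is_the_solution_def by blast
  ultimately have "AE x in lebesgue. x \<in> \<Omega> \<longrightarrow> (E x + 1 *s E'' x) + (- 1) *s E' x = E x"
    by blast
  then show "AE x in lebesgue. x \<in> \<Omega> \<longrightarrow> E'' x = E' x"
    by eventually_elim (simp add: vec_eq_iff)
qed (rule E')

end

section \<open>Integration by parts for compactly supported functions\<close>

lemma has_derivative_eq_0_outside:
  fixes f :: "'a::euclidean_space \<Rightarrow> 'b::real_normed_vector"
  assumes f: "(f has_derivative f') (at x)"
    and K: "closed K" "\<And>x. x \<notin> K \<Longrightarrow> f x = 0" and x: "x \<notin> K"
  shows "f' v = 0"
  using frechet_derivative_zero_outside[where f=f and x=x and v=v, OF K x] frechet_derivative_at[OF f]
  by simp

lemma has_vector_derivative_imp_quotient_tendsto: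
  fixes f :: "real \<Rightarrow> 'b::real_normed_vector"
  assumes "(f has_vector_derivative D) (at 0)"
  shows "((\<lambda>s. (1 / s) *\<^sub>R (f s - f 0)) \<longlongrightarrow> D) (at 0)"
proof -
  have "((\<lambda>s. norm (f s - f 0 - s *\<^sub>R D) / norm s) \<longlongrightarrow> 0) (at 0)"
    using assms by (simp add: has_vector_derivative_def has_derivative_at)
  moreover have "\<forall>\<^sub>F s in at 0. norm (f s - f 0 - s *\<^sub>R D) / norm s
                    = norm ((1 / s) *\<^sub>R (f s - f 0) - D)"
    unfolding eventually_at_filter
  proof (intro always_eventually allI impI)
    fix s :: real assume "s \<noteq> 0"
    then have "(1 / s) *\<^sub>R (f s - f 0) - D = (1 / s) *\<^sub>R (f s - f 0 - s *\<^sub>R D)"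
      by (simp add: scaleR_diff_right)
    then show "norm (f s - f 0 - s *\<^sub>R D) / norm s = norm ((1 / s) *\<^sub>R (f s - f 0) - D)"
      by simp
  qed
  ultimately have "((\<lambda>s. norm ((1 / s) *\<^sub>R (f s - f 0) - D)) \<longlongrightarrow> 0) (at 0)"
    by (rule Lim_transform_eventually)
  then show ?thesis
    by (simp add: LIM_zero_cancel tendsto_norm_zero_iff)
qed

text \<open>By translation invariance the difference quotients \<open>(h (x + t v) - h x) / t\<close> have integral zero.
  They converge to the derivative as \<open>t\<close> tends to zero and are dominated by a multiple of the
  indicator of a ball, because \<open>h\<close> is Lipschitz in direction \<open>v\<close>.\<close>

lemma integral_directional_derivative_eq_0:
  fixes h :: "'a::euclidean_space \<Rightarrow> 'b::euclidean_space"
  assumes h: "\<And>x. (h has_derivative h' x) (at x)"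
    and cont: "continuous_on UNIV (\<lambda>x. h' x v)"
    and K: "compact K" "\<And>x. x \<notin> K \<Longrightarrow> h x = 0"
  shows "(LINT x|lborel. h' x v) = 0"
proof -
  have h_cont: "continuous_on UNIV h"
    by (intro continuous_at_imp_continuous_on ballI has_derivative_continuous[OF h])
  have h'0: "h' x v = 0" if "x \<notin> K" for x
    by (rule has_derivative_eq_0_outside[OF h compact_imp_closed[OF K(1)] K(2) that])
  obtain C where C: "C > 0" "\<And>x. norm (h' x v) \<le> C"
  proof -
    have "compact ((\<lambda>x. h' x v) ` K)"
      by (intro compact_continuous_image K(1) continuous_on_subset[OF cont]) auto
    then obtain C where "C > 0" "\<forall>y\<in>(\<lambda>x. h' x v) ` K. norm y \<le> C"
      using compact_imp_bounded bounded_pos by metis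
    then have "norm (h' x v) \<le> C" for x
      by (cases "x \<in> K") (auto simp: h'0)
    with \<open>C > 0\<close> show ?thesis by (rule that)
  qed
  have lip: "norm (h (x + t *\<^sub>R v) - h x) \<le> C * \<bar>t\<bar>" for x t
  proof -
    have "((\<lambda>s. h (x + s *\<^sub>R v)) has_derivative (\<lambda>s. h' (x + s0 *\<^sub>R v) (s *\<^sub>R v)))
            (at s0 within UNIV)" for s0
      by (rule has_derivative_compose[of "\<lambda>s. x + s *\<^sub>R v", OF _ h])
         (auto intro!: derivative_eq_intros)
    moreover have "onorm (\<lambda>s. h' (x + s0 *\<^sub>R v) (s *\<^sub>R v)) \<le> C" for s0
    proof (rule onorm_le)
      fix s :: real
      have "h' (x + s0 *\<^sub>R v) (s *\<^sub>R v) = s *\<^sub>R h' (x + s0 *\<^sub>R v) v"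
        using has_derivative_bounded_linear[OF h] by (rule linear_simps(5))
      then show "norm (h' (x + s0 *\<^sub>R v) (s *\<^sub>R v)) \<le> C * norm s"
        using mult_right_mono[OF C(2)[of "x + s0 *\<^sub>R v"], of "\<bar>s\<bar>"] by (simp add: mult.commute)
    qed
    ultimately have "norm (h (x + t *\<^sub>R v) - h (x + 0 *\<^sub>R v)) \<le> C * norm (t - 0)"
      by (intro differentiable_bound[of UNIV "\<lambda>s. h (x + s *\<^sub>R v)"
            "\<lambda>s0 s. h' (x + s0 *\<^sub>R v) (s *\<^sub>R v)"]) auto
    then show ?thesis by simp
  qed
  define t where "t n = inverse (real (Suc n))" for n
  have t: "t n > 0" "t n \<le> 1" for n
    by (auto simp: t_def field_simps)
  have t0: "t \<longlonglongrightarrow> 0"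
    unfolding t_def by (rule LIMSEQ_inverse_real_of_nat)
  define q where "q n x = (1 / t n) *\<^sub>R (h (x + t n *\<^sub>R v) - h x)" for n x
  have int_h: "integrable lborel h"
    by (rule integrable_continuous_compact_support[OF h_cont K])
  have shift: "has_bochner_integral lborel (\<lambda>x. h (x + t n *\<^sub>R v)) (integral\<^sup>L lborel h)" for n
  proof -
    have "has_bochner_integral (distr lborel borel ((+) (t n *\<^sub>R v))) h (integral\<^sup>L lborel h)"
      using int_h by (simp add: lborel_distr_plus has_bochner_integral_iff)
    then have "has_bochner_integral lborel (\<lambda>x. h (t n *\<^sub>R v + x)) (integral\<^sup>L lborel h)"
      using borel_measurable_continuous_onI[OF h_cont]
      by (simp add: has_bochner_integral_iff integrable_distr_eq integral_distr)
    then show ?thesis by (simp add: add.commute)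
  qed
  have int_q: "(LINT x|lborel. q n x) = 0" for n
    unfolding q_def using shift[of n] int_h
    by (simp add: has_bochner_integral_iff)
  obtain R where R: "R > 0" "\<And>x. x \<in> K \<Longrightarrow> norm x \<le> R"
    using compact_imp_bounded[OF K(1)] bounded_pos by metis
  define B where "B = cball (0::'a) (R + norm v)"
  have "(\<lambda>n. LINT x|lborel. q n x) \<longlonglongrightarrow> (LINT x|lborel. h' x v)"
  proof (rule integral_dominated_convergence)
    show "(\<lambda>x. h' x v) \<in> borel_measurable lborel"
      using borel_measurable_continuous_onI[OF cont] by simp
    show "q n \<in> borel_measurable lborel" for n
      unfolding q_def using shift[of n] int_h by (auto simp: has_bochner_integral_iff)
    show "integrable lborel (\<lambda>x. C * indicator B x)"
      unfolding B_def by (intro integrable_mult_right integrable_real_indicator)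
         (auto intro!: emeasure_bounded_finite simp flip: infinity_ennreal_def)
    show "AE x in lborel. (\<lambda>n. q n x) \<longlonglongrightarrow> h' x v"
    proof (intro AE_I2)
      fix x
      have "((\<lambda>s. h (x + s *\<^sub>R v)) has_vector_derivative h' x v) (at 0)"
        unfolding has_vector_derivative_def
      proof (rule has_derivative_eq_rhs[OF has_derivative_compose[of "\<lambda>s. x + s *\<^sub>R v" _ _ _ h]])
        show "((\<lambda>s. x + s *\<^sub>R v) has_derivative (\<lambda>s. s *\<^sub>R v)) (at 0)"
          by (auto intro!: derivative_eq_intros)
        show "(h has_derivative h' x) (at (x + 0 *\<^sub>R v))" using h by simp
        show "(\<lambda>s. h' x (s *\<^sub>R v)) = (\<lambda>s. s *\<^sub>R h' x v)"
          using linear_simps(5)[OF has_derivative_bounded_linear[OF h]] by blast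
      qed
      then have "((\<lambda>s. (1 / s) *\<^sub>R (h (x + s *\<^sub>R v) - h x)) \<longlongrightarrow> h' x v) (at 0)"
        by (drule_tac has_vector_derivative_imp_quotient_tendsto) simp
      moreover have "filterlim t (at 0) sequentially"
        using t0 t(1) by (auto simp: filterlim_at less_imp_neq[THEN not_sym])
      ultimately show "(\<lambda>n. q n x) \<longlonglongrightarrow> h' x v"
        unfolding q_def by (rule filterlim_compose)
    qed
    show "AE x in lborel. norm (q n x) \<le> C * indicator B x" for n
    proof (intro AE_I2)
      fix x
      show "norm (q n x) \<le> C * indicator B x"
      proof (cases "x \<in> B")
        case True
        have "norm (q n x) = norm (h (x + t n *\<^sub>R v) - h x) / t n"
          using t(1)[of n] by (simp add: q_def)
        also have "\<dots> \<le> C"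
          using lip[of x "t n"] t(1)[of n] by (simp add: divide_le_eq)
        finally show ?thesis using True by simp
      next
        case False
        have "norm (t n *\<^sub>R v) \<le> norm v"
          using t[of n] by (simp add: mult_left_le_one_le)
        then have "norm (x + t n *\<^sub>R v) > R" "norm x > R"
          using False norm_diff_ineq[of x "t n *\<^sub>R v"] norm_ge_zero[of v] unfolding B_def
          by (simp_all only: mem_cball_0 not_le)
        then have "h (x + t n *\<^sub>R v) = 0" "h x = 0"
          using R(2) K(2) by (meson not_le)+
        with False show ?thesis by (simp add: q_def)
      qed
    qed
  qed
  then show ?thesis
    unfolding int_q by (simp add: LIMSEQ_const_iff)
qed

lemma integral_by_parts_compact_support:
  fixes f g :: "'a::euclidean_space \<Rightarrow> complex"
  assumes f: "\<And>x. (f has_derivative f' x) (at x)" "continuous_on UNIV (\<lambda>x. f' x v)"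
    and g: "\<And>x. (g has_derivative g' x) (at x)" "continuous_on UNIV (\<lambda>x. g' x v)"
    and K: "compact K" "\<And>x. x \<notin> K \<Longrightarrow> f x = 0"
  shows "(LINT x|lborel. f x * g' x v) = - (LINT x|lborel. f' x v * g x)"
proof -
  have cf: "continuous_on UNIV f" and cg: "continuous_on UNIV g"
    by (intro continuous_at_imp_continuous_on ballI has_derivative_continuous[OF f(1)]
          has_derivative_continuous[OF g(1)])+
  have f'0: "f' x v = 0" if "x \<notin> K" for x
    by (rule has_derivative_eq_0_outside[OF f(1) compact_imp_closed[OF K(1)] K(2) that])
  have "(LINT x|lborel. f x * g' x v + f' x v * g x) = 0"
    by (rule integral_directional_derivative_eq_0[where h="\<lambda>x. f x * g x" and K=K
          and h'="\<lambda>x w. f x * g' x w + f' x w * g x" for w])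
       (auto intro!: has_derivative_mult f g continuous_intros cf cg K(1) simp: K(2))
  moreover have "integrable lborel (\<lambda>x. f x * g' x v)" "integrable lborel (\<lambda>x. f' x v * g x)"
    by (rule integrable_continuous_compact_support[OF _ K(1)];
        auto intro!: continuous_intros f g cf cg simp: K(2) f'0)+
  ultimately show ?thesis
    by (simp add: eq_neg_iff_add_eq_0)
qed

section \<open>A curl-free field supported in a ball\<close>

lemma has_derivative_max_0_power2:
  "((\<lambda>s :: real. (max 0 s)\<^sup>2) has_real_derivative 2 * max 0 s) (at s)"
proof -
  consider "s < 0" | "s = 0" | "s > 0" by linarith
  then show ?thesis
  proof cases
    case 1
    have "((\<lambda>s :: real. 0) has_real_derivative 2 * max 0 s) (at s)"
      using 1 by simp
    then show ?thesis
      by (rule has_field_derivative_transform_within_open[where S="{..<0}"]) (use 1 in auto)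
  next
    case 2
    have "(\<lambda>h :: real. (max 0 (0 + h))\<^sup>2 / h) = (\<lambda>h. max 0 h)"
      by (auto simp: fun_eq_iff max_def power2_eq_square)
    moreover have "((\<lambda>h :: real. max 0 h) \<longlongrightarrow> max 0 0) (at 0)"
      by (intro tendsto_intros)
    ultimately show ?thesis
      using 2 by (simp add: DERIV_def)
  next
    case 3
    have "((\<lambda>s :: real. s\<^sup>2) has_real_derivative 2 * max 0 s) (at s)"
      using 3 by (auto intro!: derivative_eq_intros)
    then show ?thesis
      by (rule has_field_derivative_transform_within_open[where S="{0<..}"]) (use 3 in auto)
  qed
qed

text \<open>The gradient of \<open>- (max 0 (r\<^sup>2 - \<bar>x - a\<bar>\<^sup>2))\<^sup>3 / 6\<close>, extended to complex values. The squared
  positive part makes the field continuously differentiable, which is all that one integration by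
  parts asks for.\<close>

definition radial_field :: "real^3 \<Rightarrow> real \<Rightarrow> real^3 \<Rightarrow> complex^3" where
  "radial_field a r x = (\<chi> i. complex_of_real ((max 0 (r\<^sup>2 - (norm (x - a))\<^sup>2))\<^sup>2 * (x - a) $ i))"

lemma radial_field_eq_0_iff:
  assumes "r > 0"
  shows "radial_field a r x = 0 \<longleftrightarrow> x = a \<or> x \<notin> ball a r"
proof -
  have "radial_field a r x = 0 \<longleftrightarrow> (norm (x - a))\<^sup>2 \<ge> r\<^sup>2 \<or> x - a = 0"
    unfolding radial_field_def vec_eq_iff by (auto simp: max_def)
  also have "(norm (x - a))\<^sup>2 \<ge> r\<^sup>2 \<longleftrightarrow> x \<notin> ball a r"
    using assms by (simp add: dist_norm norm_minus_commute not_less power2_le_iff_abs_le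
        flip: abs_le_square_iff)
  finally show ?thesis by auto
qed

definition radial_field_deriv :: "real^3 \<Rightarrow> real \<Rightarrow> 3 \<Rightarrow> real^3 \<Rightarrow> real^3 \<Rightarrow> real" where
  "radial_field_deriv a r i x v =
     (max 0 (r\<^sup>2 - (norm (x - a))\<^sup>2))\<^sup>2 * v $ i
      - 4 * max 0 (r\<^sup>2 - (norm (x - a))\<^sup>2) * ((x - a) \<bullet> v) * (x - a) $ i"

lemma has_derivative_radial_field:
  "((\<lambda>x. radial_field a r x $ i) has_derivative
      (\<lambda>v. complex_of_real (radial_field_deriv a r i x v))) (at x)"
proof -
  have s: "((\<lambda>x. r\<^sup>2 - (norm (x - a))\<^sup>2) has_derivative (\<lambda>v. - 2 * ((x - a) \<bullet> v))) (at x)"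
    unfolding power2_norm_eq_inner
    by (auto intro!: derivative_eq_intros simp: inner_commute algebra_simps)
  have m: "((\<lambda>x. (max 0 (r\<^sup>2 - (norm (x - a))\<^sup>2))\<^sup>2) has_derivative
      (\<lambda>v. 2 * max 0 (r\<^sup>2 - (norm (x - a))\<^sup>2) * (- 2 * ((x - a) \<bullet> v)))) (at x)"
    using has_derivative_compose[OF s has_derivative_max_0_power2[unfolded has_field_derivative_def]] .
  have c: "((\<lambda>x. (x - a) $ i) has_derivative (\<lambda>v. v $ i)) (at x)"
    by (rule bounded_linear.has_derivative[OF bounded_linear_vec_nth])
       (auto intro!: derivative_eq_intros)
  have "((\<lambda>x. (max 0 (r\<^sup>2 - (norm (x - a))\<^sup>2))\<^sup>2 * (x - a) $ i) has_derivative
      radial_field_deriv a r i x) (at x)"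
    using has_derivative_mult[OF m c]
    by (rule has_derivative_eq_rhs) (auto simp: radial_field_deriv_def fun_eq_iff algebra_simps)
  then have "((\<lambda>x. complex_of_real ((max 0 (r\<^sup>2 - (norm (x - a))\<^sup>2))\<^sup>2 * (x - a) $ i)) has_derivative
      (\<lambda>v. complex_of_real (radial_field_deriv a r i x v))) (at x)"
    by (rule bounded_linear.has_derivative[OF bounded_linear_of_real])
  then show ?thesis by (simp add: radial_field_def)
qed

text \<open>The Jacobian of a radial field is symmetric: the off-diagonal entries are multiples of
  \<open>(x - a)\<^sub>i (x - a)\<^sub>j\<close>. This is the reason why the field is curl-free.\<close>

lemma radial_field_deriv_sym:
  "radial_field_deriv a r i x (axis j 1) = radial_field_deriv a r j x (axis i 1)"
  unfolding radial_field_deriv_def inner_axis by (simp add: axis_def)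

lemma continuous_on_radial_field_deriv: "continuous_on UNIV (\<lambda>x. radial_field_deriv a r i x v)"
  unfolding radial_field_deriv_def by (intro continuous_intros)

lemma continuous_on_radial_field: "continuous_on UNIV (radial_field a r)"
  unfolding radial_field_def by (intro continuous_intros)

text \<open>Integration by parts moves the derivatives from \<open>\<Phi>\<close> to the radial field, where the terms of
  the curl cancel in pairs by symmetry of the Jacobian.\<close>

lemma integral_radial_field_curl_test:
  assumes r: "r > 0" and \<Phi>: "\<Phi> \<in> test_functions S"
  shows "(LINT x|lborel. hdot (radial_field a r x) (curl \<Phi> x)) = 0"
proof -
  define \<delta> where "\<delta> i x = radial_field a r x $ i" for i x
  define d where "d j k x = cnj (frechet_derivative \<Phi> (at x) (axis j 1) $ k)" for j k x
  define T where "T i j k = (LINT x|lborel. \<delta> i x * d j k x)" for i j k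
  have \<delta>0: "\<delta> i x = 0" if "x \<notin> cball a r" for i x
    using that radial_field_eq_0_iff[OF r, of a x] by (simp add: \<delta>_def)
  have d_cont: "continuous_on UNIV (d j k)" for j k
    unfolding d_def by (intro continuous_intros test_functionsD(3)[OF \<Phi>])
  have \<delta>_cont: "continuous_on UNIV (\<delta> i)" for i
    unfolding \<delta>_def by (intro continuous_intros continuous_on_radial_field)
  have int: "integrable lborel (\<lambda>x. \<delta> i x * d j k x)" for i j k
    by (rule integrable_continuous_compact_support[of _ "cball a r"])
       (auto intro!: continuous_on_mult \<delta>_cont d_cont simp del: mem_cball simp: \<delta>0)
  have parts: "T i j k = - (LINT x|lborel. complex_of_real (radial_field_deriv a r i x (axis j 1))
                                     * cnj (\<Phi> x $ k))" for i j k
    unfolding T_def d_def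
  proof (rule integral_by_parts_compact_support[of "\<delta> i" _ "axis j 1" "\<lambda>x. cnj (\<Phi> x $ k)"
        "\<lambda>x v. cnj (frechet_derivative \<Phi> (at x) v $ k)" "cball a r"])
    show "(\<delta> i has_derivative (\<lambda>v. complex_of_real (radial_field_deriv a r i x v))) (at x)" for x
      unfolding \<delta>_def by (rule has_derivative_radial_field)
    show "continuous_on UNIV (\<lambda>x. complex_of_real (radial_field_deriv a r i x (axis j 1)))"
      by (intro continuous_on_of_real continuous_on_radial_field_deriv)
    show "((\<lambda>x. cnj (\<Phi> x $ k)) has_derivative
             (\<lambda>v. cnj (frechet_derivative \<Phi> (at x) v $ k))) (at x)" for x
      by (rule bounded_linear.has_derivative[OF bounded_linear_cnj
            has_derivative_test_component[OF \<Phi>]])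
    show "continuous_on UNIV (\<lambda>x. cnj (frechet_derivative \<Phi> (at x) (axis j 1) $ k))"
      using d_cont[of j k] by (simp add: d_def)
  qed (auto simp: \<delta>0 simp del: mem_cball)
  have sym: "T i j k = T j i k" for i j k
    unfolding parts radial_field_deriv_sym[of a r i _ j] ..
  have "hdot (radial_field a r x) (curl \<Phi> x)
      = (\<delta> 1 x * d 2 3 x - \<delta> 1 x * d 3 2 x) + (\<delta> 2 x * d 3 1 x - \<delta> 2 x * d 1 3 x)
        + (\<delta> 3 x * d 1 2 x - \<delta> 3 x * d 2 1 x)" for x
    by (simp add: hdot_def sum_3 curl_def partial_test_component[OF \<Phi>] \<delta>_def d_def
        right_diff_distrib)
  then have "(LINT x|lborel. hdot (radial_field a r x) (curl \<Phi> x))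
      = (T 1 2 3 - T 1 3 2) + (T 2 3 1 - T 2 1 3) + (T 3 1 2 - T 3 2 1)"
    by (simp add: T_def int)
  also have "\<dots> = 0"
    using sym[of 1 2 3] sym[of 1 3 2] sym[of 2 3 1] by simp
  finally show ?thesis .
qed

lemma L2_on_radial_field:
  assumes r: "r > 0" and D: "D \<in> sets lebesgue"
  shows "L2_on D (radial_field a r)"
proof (rule L2_on_continuous_compact_support[OF continuous_on_radial_field compact_cball[of a r] _ D])
  show "radial_field a r x = 0" if "x \<notin> cball a r" for x
    using that radial_field_eq_0_iff[OF r, of a x] by simp
qed

text \<open>The test field may be nonzero on the boundary of \<open>D\<close>: since the radial field vanishes outside
  \<open>D\<close>, the integral runs over the whole space. Hence this single identity says both that the weak
  curl vanishes and that the tangential trace vanishes on every part of the boundary.\<close>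

lemma tangential_trace_radial_field:
  assumes r: "r > 0" and D: "D \<in> sets lebesgue" "cball a r \<subseteq> D" and \<Phi>: "\<Phi> \<in> test_functions S"
  shows "tangential_trace D (radial_field a r) (\<lambda>_. 0) \<Phi> = 0"
proof -
  have "radial_field a r x = 0" if "x \<notin> cball a r" for x
    using that radial_field_eq_0_iff[OF r, of a x] by simp
  then have "(\<lambda>x. indicator D x *\<^sub>R hdot (radial_field a r x) (curl \<Phi> x))
      = (\<lambda>x. hdot (radial_field a r x) (curl \<Phi> x))"
    using D(2) by (force simp: indicator_def fun_eq_iff hdot.zero_left)
  moreover have "(\<lambda>x. hdot (radial_field a r x) (curl \<Phi> x)) \<in> borel_measurable lborel"
    using borel_measurable_continuous_onI[OF hdot.continuous_on[OF continuous_on_radial_field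
          continuous_on_curl_test_function[OF \<Phi>]]] by simp
  ultimately have "(LINT x:D|lebesgue. hdot (radial_field a r x) (curl \<Phi> x)) = 0"
    using integral_radial_field_curl_test[OF r \<Phi>, of a]
    by (simp add: set_lebesgue_integral_def integral_completion)
  moreover have "tangential_trace D (radial_field a r) (\<lambda>_. 0) \<Phi>
      = - (LINT x:D|lebesgue. hdot (radial_field a r x) (curl \<Phi> x))"
    by (simp add: tangential_trace_def hdot.zero_left set_lebesgue_integral_def)
  ultimately show ?thesis by simp
qed

lemma Hcurl_radial_field:
  assumes "r > 0" "D \<in> sets lebesgue" "cball a r \<subseteq> D"
  shows "Hcurl D (radial_field a r) (\<lambda>_. 0)"
  using assms
  by (simp add: Hcurl_def L2_on_radial_field L2_on_zero weak_curl_on_iff_tangential_trace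
      tangential_trace_radial_field)

section \<open>Non-uniqueness of the source\<close>

lemma tangential_trace_eq_refl: "Hcurl D u w \<Longrightarrow> tangential_trace_eq D S u u"
  unfolding tangential_trace_eq_def by blast

lemma tangential_trace_eq_radial_field:
  assumes "r > 0" "D \<in> sets lebesgue" "cball a r \<subseteq> D"
  shows "tangential_trace_eq D S (radial_field a r) (\<lambda>_. 0)"
proof -
  have "Hcurl D (\<lambda>_. 0) (\<lambda>_. 0)"
    by (simp add: Hcurl_def L2_on_zero weak_curl_on_def hdot.zero_left)
  moreover have "tangential_trace D (\<lambda>_. 0) (\<lambda>_. 0) \<Phi> = 0" for \<Phi>
    by (simp add: tangential_trace_def hdot.zero_left)
  ultimately show ?thesis
    using Hcurl_radial_field[OF assms] tangential_trace_radial_field[OF assms] boundary_test_fieldsD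
    unfolding tangential_trace_eq_def by metis
qed

text \<open>Needed for \<open>\<sigma>0\<close>, whose values are prescribed only on \<open>\<Omega>0\<close> and \<open>\<Omega>c\<close> and not on the interface
  between them.\<close>

lemma negligible_frontier_polyhedral_domain:
  assumes "polyhedral_domain D"
  shows "negligible (closure D - D)"
proof -
  obtain \<P> where \<P>: "finite \<P>" "\<And>P. P \<in> \<P> \<Longrightarrow> polytope P" "closure D = \<Union>\<P>"
    using assms unfolding polyhedral_domain_def by blast
  have "closure D - D = frontier (closure D)"
    using assms by (simp add: polyhedral_domain_def frontier_def)
  also have "\<dots> \<subseteq> (\<Union>P\<in>\<P>. frontier P)"
    unfolding \<P>(3) by (rule frontier_Union_subset[OF \<P>(1)])
  finally have "closure D - D \<subseteq> (\<Union>P\<in>\<P>. frontier P)" .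
  moreover have "negligible (\<Union>P\<in>\<P>. frontier P)"
    using \<P> by (intro negligible_Union) (auto intro: negligible_convex_frontier polytope_imp_convex)
  ultimately show ?thesis by (rule negligible_subset[rotated])
qed

lemma not_AE_zero_radial_field:
  assumes "r > 0"
  shows "\<not> (AE x in lebesgue. x \<in> ball a r \<longrightarrow> radial_field a r x = 0)"
proof
  assume "AE x in lebesgue. x \<in> ball a r \<longrightarrow> radial_field a r x = 0"
  then have "AE x in lebesgue. x \<notin> ball a r - {a}"
    by eventually_elim (use radial_field_eq_0_iff[OF assms] in auto)
  then have "ball a r - {a} \<in> null_sets lebesgue"
    by (simp add: completion.null_sets_iff_AE)
  then have "negligible (ball a r - {a})"
    by (simp add: negligible_iff_null_sets)
  then have "negligible (ball a r)"
    using negligible_subset[OF negligible_Un[OF _ negligible_sing]] by blast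
  then show False
    using open_not_negligible[OF open_ball, of a r] assms by (simp add: not_le)
qed

theorem theorem3p2:
  fixes \<Omega> \<Omega>0 \<Omega>c \<Gamma> :: "(real^3) set"
    and \<mu> \<epsilon> \<sigma>0 \<sigma> :: "real^3 \<Rightarrow> real"
    and \<omega> :: real
    and Js E\<sigma> E0 :: "real^3 \<Rightarrow> complex^3"
  assumes Omega: "is_domain \<Omega>" "bounded \<Omega>" "convex \<Omega>" "piecewise_smooth_boundary \<Omega>"
    and Omega0: "\<Omega>0 \<subseteq> \<Omega>" "polyhedral_domain \<Omega>0" "simply_connected \<Omega>0"
    and Omegac: "\<Omega>c = \<Omega> - closure \<Omega>0" "polyhedral_domain \<Omega>c" "simply_connected \<Omega>c"
    and interface: "Lipschitz_polyhedral_surface (frontier \<Omega>0 \<inter> frontier \<Omega>c)"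
                   "simply_connected (frontier \<Omega>0 \<inter> frontier \<Omega>c)"
    and Gamma: "openin (top_of_set (frontier \<Omega>)) \<Gamma>" "\<Gamma> \<subseteq> frontier \<Omega>0"
    and omega: "\<omega> > 0"
    and mu: "\<forall>x\<in>\<Omega>. \<mu> x > 0" "piecewise_constant_on \<Omega> \<mu>"
    and eps: "\<forall>x\<in>\<Omega>0. \<epsilon> x > 0" "piecewise_constant_on \<Omega>0 \<epsilon>"
    and sigma0: "\<exists>c>0. \<forall>x\<in>\<Omega>c. \<sigma>0 x = c" "\<forall>x\<in>\<Omega>0. \<sigma>0 x = 0"
    and sigma: "Linfty \<sigma>" "compactly_supported_in \<Omega>c \<sigma>"
    and Js: "L2_on \<Omega> Js" "compactly_supported_in \<Omega>0 Js" "weakly_divergence_free_on \<Omega> Js"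
    and Esigma: "is_the_solution \<Omega> \<Omega>0 \<Gamma> \<mu> \<epsilon> \<omega> (\<lambda>x. \<sigma>0 x + \<sigma> x)
                   (\<lambda>x. (\<i> * complex_of_real \<omega>) *s Js x) E\<sigma>"
    and E0: "is_the_solution \<Omega> \<Omega>0 \<Gamma> \<mu> \<epsilon> \<omega> \<sigma>0
                   (\<lambda>x. (\<i> * complex_of_real \<omega>) *s Js x) E0"
    and nonzero_data: "\<not> tangential_trace_eq \<Omega> \<Gamma> (\<lambda>x. E\<sigma> x - E0 x) (\<lambda>_. 0)"
  shows "\<exists>J :: real^3 \<Rightarrow> complex^3.
           L2_on \<Omega>c J \<and> (\<forall>x. x \<notin> \<Omega>c \<longrightarrow> J x = 0) \<and>
           \<not> (AE x in lebesgue. x \<in> \<Omega>c \<longrightarrow> J x = (\<i> * complex_of_real (\<omega> * \<sigma> x)) *s E\<sigma> x) \<and>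
           (\<exists>E. is_the_solution \<Omega> \<Omega>0 \<Gamma> \<mu> \<epsilon> \<omega> \<sigma>0 J E \<and>
                tangential_trace_eq \<Omega> \<Gamma> E (\<lambda>x. E\<sigma> x - E0 x))"
proof -
  have doms: "is_domain \<Omega>" "is_domain \<Omega>0" "is_domain \<Omega>c"
    using Omega Omega0 Omegac by (auto simp: polyhedral_domain_def)
  then have sets: "\<Omega> \<in> sets lebesgue" "\<Omega>0 \<in> sets lebesgue" "\<Omega>c \<in> sets lebesgue"
    by (auto simp: is_domain_def)
  have \<Omega>c: "\<Omega>c \<subseteq> \<Omega>" "\<Omega>0 \<inter> \<Omega>c = {}"
    using Omegac(1) closure_subset[of \<Omega>0] by auto
  obtain c where c: "c > 0" "\<And>x. x \<in> \<Omega>c \<Longrightarrow> \<sigma>0 x = c"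
    using sigma0(1) by blast

  interpret eddy_current_problem \<Omega> \<Omega>0 \<Gamma> \<mu> \<epsilon> \<omega>
    using sets Omega0(1) mu(2) eps(2)
    by unfold_locales (auto intro: piecewise_constant_on_imp_ess_bounded_on
          piecewise_constant_on_inverse)

  \<comment> \<open>The air region and the conductor are the two pieces; the interface is a null set.\<close>
  have "piecewise_constant_on \<Omega> \<sigma>0"
    unfolding piecewise_constant_on_def
  proof (intro exI[of _ "{\<Omega>0, \<Omega>c}"] conjI ballI)
    show "negligible (\<Omega> - \<Union>{\<Omega>0, \<Omega>c})"
      using negligible_frontier_polyhedral_domain[OF Omega0(2)]
      by (rule negligible_subset) (auto simp: Omegac(1))
    show "pairwise disjnt {\<Omega>0, \<Omega>c}"
      using \<Omega>c(2) by (auto simp: pairwise_insert disjnt_def)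
  qed (use doms Omega0(1) \<Omega>c(1) sigma0(2) c(2) in \<open>auto simp: constant_on_def\<close>)
  then have \<sigma>0: "ess_bounded_on \<Omega> \<sigma>0"
    by (rule piecewise_constant_on_imp_ess_bounded_on)
  have \<sigma>: "ess_bounded_on \<Omega> \<sigma>"
    by (rule Linfty_imp_ess_bounded_on[OF sigma(1) sets(1)])
  have \<sigma>_supp: "\<sigma> x = 0" if "x \<notin> \<Omega>c" for x
    using sigma(2) that zero_outside_supp[of x \<sigma>] by (auto simp: compactly_supported_in_def)

  obtain a where "a \<in> \<Omega>c" using doms(3) by (auto simp: is_domain_def)
  then obtain r where r: "r > 0" "cball a r \<subseteq> \<Omega>c"
    using doms(3) open_contains_cball[of \<Omega>c] by (auto simp: is_domain_def)
  define \<delta> where "\<delta> = radial_field a r"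
  have r\<Omega>: "cball a r \<subseteq> \<Omega>" using r(2) \<Omega>c(1) by blast
  have \<delta>0: "\<delta> x = 0" if "x \<notin> \<Omega>c" for x
  proof -
    have "x \<notin> ball a r" using that r(2) ball_subset_cball by blast
    then show ?thesis unfolding \<delta>_def radial_field_eq_0_iff[OF r(1)] by blast
  qed
  have \<delta>_trace: "tangential_trace_eq \<Omega> S \<delta> (\<lambda>_. 0)" for S
    unfolding \<delta>_def by (rule tangential_trace_eq_radial_field[OF r(1) sets(1) r\<Omega>])
  have \<delta>_Hcurl: "Hcurl_Gamma \<Omega> \<Gamma> \<delta> (\<lambda>_. 0)"
    using Hcurl_radial_field[OF r(1) sets(1) r\<Omega>] \<delta>_trace
    by (simp add: Hcurl_Gamma_def \<delta>_def)

  \<comment> \<open>The sources of \<open>E0\<close>, of \<open>E\<sigma> - E0\<close> and of \<open>\<delta>\<close> for the conductivity \<open>\<sigma>0\<close>.\<close>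
  define f where "f x = (\<i> * complex_of_real \<omega>) *s Js x" for x
  have f_eq: "(\<lambda>x. (\<i> * complex_of_real \<omega>) *s Js x) = f"
    by (simp add: f_def fun_eq_iff)
  define g where "g x = (\<i> * complex_of_real (\<omega> * \<sigma> x)) *s E\<sigma> x" for x
  define h where "h x = - ((\<i> * complex_of_real (\<omega> * \<sigma>0 x)) *s \<delta> x)" for x
  have L2E: "L2_on \<Omega> E\<sigma>" "L2_on \<Omega> E0" "L2_on \<Omega> \<delta>"
    using Esigma E0 \<delta>_Hcurl
    by (auto simp: is_the_solution_def weak_solution_def Hcurl_Gamma_def Hcurl_def)
  have f: "L2_on \<Omega> f"
    unfolding f_def by (rule L2_on_bounded_linear[OF Js(1) bounded_linear_cscale])
  have source_L2: "L2_on \<Omega> (\<lambda>x. (k * complex_of_real (\<omega> * s x)) *s u x)"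
    if "ess_bounded_on \<Omega> s" "L2_on \<Omega> u" for k s and u :: "real^3 \<Rightarrow> complex^3"
  proof -
    have "(k * complex_of_real (\<omega> * s x)) *s u x = k *s ((\<omega> * s x) *\<^sub>R u x)" for x
      by (simp add: vec_eq_iff scaleR_conv_of_real[where 'a=complex] mult.assoc)
    then show ?thesis
      using L2_on_bounded_linear[OF L2_on_ess_bounded_scaleR[OF
          ess_bounded_on_const_mult[OF that(1)] that(2)] bounded_linear_cscale]
      by simp
  qed
  have g: "L2_on \<Omega> g"
    unfolding g_def by (rule source_L2[OF \<sigma> L2E(1)])
  have "h = (\<lambda>x. (- \<i> * complex_of_real (\<omega> * \<sigma>0 x)) *s \<delta> x)"
    by (simp add: h_def fun_eq_iff vec_eq_iff)
  then have h: "L2_on \<Omega> h"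
    using source_L2[OF \<sigma>0 L2E(3), of "- \<i>"] by simp

  define J where "J x = g x + h x" for x
  define E where "E x = (E\<sigma> x - E0 x) + \<delta> x" for x
  have sol_\<sigma>: "weak_solution \<Omega> \<Omega>0 \<Gamma> \<mu> \<epsilon> \<omega> \<sigma>0 (\<lambda>x. f x + g x) E\<sigma>"
    unfolding g_def using Esigma
    by (intro weak_solution_conductivity_to_source \<sigma>0 \<sigma> f) (simp add: is_the_solution_def f_eq)
  have sol_0: "weak_solution \<Omega> \<Omega>0 \<Gamma> \<mu> \<epsilon> \<omega> \<sigma>0 f E0"
    using E0 by (simp add: is_the_solution_def f_eq)
  have sol_\<delta>: "weak_solution \<Omega> \<Omega>0 \<Gamma> \<mu> \<epsilon> \<omega> \<sigma>0 h \<delta>"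
    unfolding h_def using \<Omega>c(2) \<delta>0 by (intro weak_solution_curl_free \<delta>_Hcurl) auto
  have "weak_solution \<Omega> \<Omega>0 \<Gamma> \<mu> \<epsilon> \<omega> \<sigma>0
      (\<lambda>x. ((f x + g x) + (- 1) *s f x) + 1 *s h x) (\<lambda>x. (E\<sigma> x + (- 1) *s E0 x) + 1 *s \<delta> x)"
    by (intro weak_solution_add_cscale L2_on_add_cscale L2_on_add f g h \<sigma>0 sol_\<sigma> sol_0 sol_\<delta>)
  moreover have "(\<lambda>x. ((f x + g x) + (- 1) *s f x) + 1 *s h x) = J"
    by (simp add: J_def fun_eq_iff vec_eq_iff)
  moreover have "(\<lambda>x. (E\<sigma> x + (- 1) *s E0 x) + 1 *s \<delta> x) = E"
    by (simp add: E_def fun_eq_iff vec_eq_iff)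
  ultimately have "weak_solution \<Omega> \<Omega>0 \<Gamma> \<mu> \<epsilon> \<omega> \<sigma>0 J E"
    by (simp only:)
  moreover have J: "L2_on \<Omega> J"
    unfolding J_def by (rule L2_on_add[OF g h])
  ultimately have sol: "is_the_solution \<Omega> \<Omega>0 \<Gamma> \<mu> \<epsilon> \<omega> \<sigma>0 J E"
    using is_the_solution_other_source[OF \<sigma>0 f _ E0[unfolded f_eq]] by blast

  obtain w0 w1 where "Hcurl \<Omega> E\<sigma> w1" "Hcurl \<Omega> E0 w0"
    using Esigma E0 by (auto simp: is_the_solution_def weak_solution_def Hcurl_Gamma_def)
  then have "Hcurl \<Omega> (\<lambda>x. E\<sigma> x + (- 1) *s E0 x) (\<lambda>x. w1 x + (- 1) *s w0 x)"
    by (rule Hcurl_add_cscale[OF sets(1)])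
  then have "tangential_trace_eq \<Omega> \<Gamma> (\<lambda>x. (E\<sigma> x + (- 1) *s E0 x) + 1 *s \<delta> x)
      (\<lambda>x. (E\<sigma> x + (- 1) *s E0 x) + 1 *s 0)"
    by (intro tangential_trace_eq_add_cscale[OF sets(1)] tangential_trace_eq_refl \<delta>_trace)
  moreover have "(\<lambda>x. (E\<sigma> x + (- 1) *s E0 x) + 1 *s \<delta> x) = E"
      "(\<lambda>x. (E\<sigma> x + (- 1) *s E0 x) + 1 *s 0) = (\<lambda>x. E\<sigma> x - E0 x)"
    by (simp_all add: E_def fun_eq_iff vec_eq_iff)
  ultimately have trace: "tangential_trace_eq \<Omega> \<Gamma> E (\<lambda>x. E\<sigma> x - E0 x)"
    by (simp only:)

  \<comment> \<open>The two sources differ by \<open>h\<close>, which vanishes in the ball only at its centre.\<close>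
  have "\<not> (AE x in lebesgue. x \<in> \<Omega>c \<longrightarrow> J x = g x)"
  proof
    assume "AE x in lebesgue. x \<in> \<Omega>c \<longrightarrow> J x = g x"
    then have "AE x in lebesgue. x \<in> ball a r \<longrightarrow> radial_field a r x = 0"
    proof eventually_elim
      case (elim x)
      show ?case
      proof
        assume "x \<in> ball a r"
        then have "x \<in> \<Omega>c" using r(2) by auto
        then have "h x = 0" "\<sigma>0 x = c" using elim c(2) by (auto simp: J_def)
        then show "radial_field a r x = 0"
          using c(1) omega by (simp add: h_def \<delta>_def vec_eq_iff)
      qed
    qed
    with not_AE_zero_radial_field[OF r(1)] show False by blast
  qed
  moreover have "J x = 0" if "x \<notin> \<Omega>c" for x
    using that by (simp add: J_def g_def h_def \<sigma>_supp \<delta>0 vec_eq_iff)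
  moreover have "L2_on \<Omega>c J"
    by (rule L2_on_subset[OF J sets(3) \<Omega>c(1)])
  ultimately show ?thesis
    using sol trace unfolding g_def by blast
qed

end
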